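(* Let $A$ be a $C^*$-algebra and let $I \subseteq A$ be a (two-sided, not necessarily norm-closed) ideal. Then the semiprime closure of $I$ is the union of some increasing sequence $L_1 \subseteq L_2 \subseteq \ldots$ of ideals of $A$, each of which is radical over $I$. Further, every one-sided nil ideal in the quotient ring $A/I$ is contained in the prime radical of $A/I$.
   Context: $C^*$-algebras are not assumed unital, and $A/I$ is regarded as a (not necessarily unital) ring. An ideal in a ring $R$ (in particular in a $C^*$-algebra) is an additive subgroup $J \subseteq R$ with $aJ \cup Ja \subseteq J$ for all $a \in R$; one-sided (left or right) ideals are defined analogously. Ideals in $C^*$-algebras are not assumed norm-closed, self-adjoint, or closed under complex scalars. For ideals $J,K$, $JK$ is the additive subgroup generated by $\{xy : x \in J, y \in K\}$. An ideal $P$ in a ring $R$ is prime if $P \neq R$ and for all ideals $J,K \subseteq R$, $JK \subseteq P$ implies $J \subseteq P$ or $K \subseteq P$. An ideal $P$ is semiprime if for all ideals $J \subseteq R$, $J^2 \subseteq P$ implies $J \subseteq P$. The semiprime closure $\sqrt{I}$ of an ideal $I \subseteq R$ is the intersection of all prime ideals of $R$ containing $I$ (with $\sqrt{I} = R$ if there are none); equivalently, it is the smallest semiprime ideal containing $I$. The prime radical of a ring $R$ is $\sqrt{0}$, the semiprime closure of its zero ideal. A (one-sided) ideal is nil if each of its elements is nilpotent. An ideal $L \subseteq A$ is radical over $I$ if for every $x \in L$ there exists $n \geq 1$ with $x^n \in I$. *)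

theory Defs
  imports Complex_Main "HOL-Algebra.QuotRing" "HOL-Algebra.Generated_Groups"
begin

section \<open>C*-algebras\<close>

text \<open>No unit is required. The real structure supplied by \<^class>\<open>real_normed_algebra\<close> is the
  restriction of the complex one.\<close>

class cstar_algebra = real_normed_algebra + banach +
  fixes cscale :: "complex \<Rightarrow> 'a \<Rightarrow> 'a"
    and star :: "'a \<Rightarrow> 'a"
  assumes cscale_add_right: "cscale a (x + y) = cscale a x + cscale a y"
    and cscale_add_left: "cscale (a + b) x = cscale a x + cscale b x"
    and cscale_cscale: "cscale a (cscale b x) = cscale (a * b) x"
    and cscale_of_real: "cscale (complex_of_real r) x = r *\<^sub>R x"
    and norm_cscale: "norm (cscale a x) = cmod a * norm x"
    and mult_cscale_left: "cscale a x * y = cscale a (x * y)"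
    and mult_cscale_right: "x * cscale a y = cscale a (x * y)"
    and star_add: "star (x + y) = star x + star y"
    and star_cscale: "star (cscale a x) = cscale (cnj a) (star x)"
    and star_mult: "star (x * y) = star y * star x"
    and star_star: "star (star x) = x"
    and norm_star_mult: "norm (star x * x) = (norm x)\<^sup>2"

text \<open>Rings below need not have a unit, while the type \<^typ>\<open>'a ring\<close> has a \<open>one\<close> field. That field
  is left unspecified here, and no definition in this theory depends on it; in a quotient formed
  with \<^const>\<open>FactRing\<close>, the carrier, addition, zero and multiplication do not depend on it
  either.\<close>

definition cstar_ring :: "'a::cstar_algebra ring" where
  "cstar_ring = \<lparr>carrier = UNIV, mult = (*), one = undefined, zero = 0, add = (+)\<rparr>"


section \<open>Ideals in rings without unit\<close>

text \<open>The locale \<^locale>\<open>ideal\<close> of HOL-Algebra includes a unital ring, and so cannot be used.\<close>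

definition rng_left_ideal :: "'a set \<Rightarrow> ('a, 'b) ring_scheme \<Rightarrow> bool" where
  "rng_left_ideal J R \<longleftrightarrow>
     additive_subgroup J R \<and> (\<forall>a\<in>carrier R. \<forall>x\<in>J. a \<otimes>\<^bsub>R\<^esub> x \<in> J)"

definition rng_right_ideal :: "'a set \<Rightarrow> ('a, 'b) ring_scheme \<Rightarrow> bool" where
  "rng_right_ideal J R \<longleftrightarrow>
     additive_subgroup J R \<and> (\<forall>a\<in>carrier R. \<forall>x\<in>J. x \<otimes>\<^bsub>R\<^esub> a \<in> J)"

definition rng_ideal :: "'a set \<Rightarrow> ('a, 'b) ring_scheme \<Rightarrow> bool" where
  "rng_ideal J R \<longleftrightarrow> rng_left_ideal J R \<and> rng_right_ideal J R"

definition rng_ideal_mult :: "('a, 'b) ring_scheme \<Rightarrow> 'a set \<Rightarrow> 'a set \<Rightarrow> 'a set" where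
  "rng_ideal_mult R J K = generate (add_monoid R) {x \<otimes>\<^bsub>R\<^esub> y | x y. x \<in> J \<and> y \<in> K}"

definition rng_prime_ideal :: "'a set \<Rightarrow> ('a, 'b) ring_scheme \<Rightarrow> bool" where
  "rng_prime_ideal P R \<longleftrightarrow>
     rng_ideal P R \<and> P \<noteq> carrier R \<and>
     (\<forall>J K. rng_ideal J R \<longrightarrow> rng_ideal K R \<longrightarrow> rng_ideal_mult R J K \<subseteq> P \<longrightarrow> J \<subseteq> P \<or> K \<subseteq> P)"

text \<open>Intersecting inside the carrier yields the whole ring when no prime ideal contains \<open>I\<close>.\<close>

definition semiprime_closure :: "('a, 'b) ring_scheme \<Rightarrow> 'a set \<Rightarrow> 'a set" where
  "semiprime_closure R I = carrier R \<inter> \<Inter> {P. rng_prime_ideal P R \<and> I \<subseteq> P}"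

definition prime_radical :: "('a, 'b) ring_scheme \<Rightarrow> 'a set" where
  "prime_radical R = semiprime_closure R {\<zero>\<^bsub>R\<^esub>}"


section \<open>Powers and nilpotence\<close>

text \<open>The power operation of HOL-Algebra starts at the unit, hence this replacement. It is the
  usual power for exponents \<open>n \<ge> 1\<close>; its value at exponent 0 is irrelevant.\<close>

definition rng_pow :: "('a, 'b) ring_scheme \<Rightarrow> 'a \<Rightarrow> nat \<Rightarrow> 'a" where
  "rng_pow R x n = ((\<lambda>y. y \<otimes>\<^bsub>R\<^esub> x) ^^ (n - 1)) x"

definition radical_over :: "('a, 'b) ring_scheme \<Rightarrow> 'a set \<Rightarrow> 'a set \<Rightarrow> bool" where
  "radical_over R L I \<longleftrightarrow> (\<forall>x\<in>L. \<exists>n\<ge>1. rng_pow R x n \<in> I)"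

definition rng_nil :: "('a, 'b) ring_scheme \<Rightarrow> 'a set \<Rightarrow> bool" where
  "rng_nil R N \<longleftrightarrow> (\<forall>x\<in>N. \<exists>n\<ge>1. rng_pow R x n = \<zero>\<^bsub>R\<^esub>)"

end

theory Submission
  imports Defs "HOL-Analysis.Operator_Norm"
begin

text \<open>The union \<open>W\<close> of all ideals that are nilpotent modulo \<open>I\<close> is an ideal contained in every
  prime ideal over \<open>I\<close>. Everything follows once \<open>(x\<^sup>* x)\<^sup>n \<in> I\<close> is known to imply \<open>x \<in> W\<close>: then
  \<open>x A x \<subseteq> W\<close> implies \<open>x \<in> W\<close>, since \<open>x x\<^sup>* x \<in> W\<close>, so \<open>W\<close> is semiprime; and if \<open>x\<close> represents an
  element of a nil left ideal of \<open>A/I\<close>, so does \<open>x\<^sup>* x\<close>.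

  For that implication let \<open>q\<close> be the 16th root of a multiple of \<open>x\<^sup>* x\<close>, so that \<open>x\<close> lies in the
  ideal \<open>J\<^sub>m = A q\<^sup>m A\<close> for small \<open>m\<close>, while \<open>J\<^sub>m \<subseteq> I\<close> for large \<open>m\<close>. By polarization \<open>J\<^sub>m J\<^sub>m\<close> is
  spanned by the elements \<open>u b v\<close> with \<open>b = (z q\<^sup>m)\<^sup>* (z q\<^sup>m)\<close>. Here \<open>c = b\<^bsup>1/2\<^esup>\<close> satisfies
  \<open>\<parallel>c g\<parallel> = \<parallel>z q\<^sup>m g\<parallel>\<close> for all \<open>g\<close>; letting \<open>g\<close> approximate negative powers of \<open>q\<close> shows that \<open>c\<close> is
  divisible by \<open>q\<^bsup>m-1\<^esup>\<close> on the right, and on the left as \<open>c\<^sup>* = c\<close>, so \<open>b = c c\<close> is divisible by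
  \<open>q\<^bsup>2m-2\<^esup>\<close>. Thus passing from \<open>J\<^sub>m\<close> to its square almost doubles \<open>m\<close>, and finitely many steps
  show that \<open>J\<^sub>m\<close> is nilpotent modulo \<open>I\<close>.

  The functional calculus is replaced by explicit approximations in the unitization. As positivity
  of \<open>x\<^sup>* x\<close> is not established, \<open>b\<close> is in fact written as a product of \<open>|b|\<^bsup>1/2\<^esup>\<close> and
  \<open>sgn(b) |b|\<^bsup>1/2\<^esup>\<close>.\<close>

section \<open>The unitization of a C*-algebra\<close>

lemma star_zero [simp]: "star (0::'a::cstar_algebra) = 0"
  using star_add[of 0 0] by simp

lemma star_minus [simp]: "star (- x) = - star x" for x :: "'a::cstar_algebra"
proof -
  have "star x + star (- x) = 0" by (simp flip: star_add)
  then show ?thesis by (simp add: add_eq_0_iff)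
qed

lemma star_diff: "star (x - y) = star x - star y" for x :: "'a::cstar_algebra"
  using star_add[of x "- y"] by simp

lemma star_scaleR: "star (r *\<^sub>R x) = r *\<^sub>R star x" for x :: "'a::cstar_algebra"
  using star_cscale[of "complex_of_real r" x] by (simp add: cscale_of_real)

lemma norm_star [simp]: "norm (star x) = norm x" for x :: "'a::cstar_algebra"
proof -
  have le: "norm y \<le> norm (star y)" for y
  proof (cases "norm y = 0")
    case False
    have "norm y * norm y \<le> norm (star y) * norm y"
      using norm_mult_ineq[of "star y" y] norm_star_mult[of y] by (simp add: power2_eq_square)
    then show ?thesis using False by simp
  qed simp
  show ?thesis using le[of x] le[of "star x"] by (simp add: star_star)
qed

lemma cscale_zero_right [simp]: "cscale a (0::'a::cstar_algebra) = 0"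
  using cscale_add_right[of a 0 0] by simp

lemma cscale_zero_left [simp]: "cscale 0 x = 0" for x :: "'a::cstar_algebra"
  using cscale_add_left[of 0 0 x] by simp

lemma cscale_one [simp]: "cscale 1 x = x" for x :: "'a::cstar_algebra"
  using cscale_of_real[of 1 x] by simp

lemma cscale_minus_right: "cscale a (- x) = - cscale a x" for x :: "'a::cstar_algebra"
proof -
  have "cscale a x + cscale a (- x) = 0" by (simp flip: cscale_add_right)
  then show ?thesis by (simp add: add_eq_0_iff)
qed

lemma cscale_diff_right: "cscale a (x - y) = cscale a x - cscale a y" for x :: "'a::cstar_algebra"
  using cscale_add_right[of a x "- y"] by (simp add: cscale_minus_right)

lemma cscale_minus_left: "cscale (- a) x = - cscale a x" for x :: "'a::cstar_algebra"
proof -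
  have "cscale a x + cscale (- a) x = 0" by (simp flip: cscale_add_left)
  then show ?thesis by (simp add: add_eq_0_iff)
qed

lemma cscale_scaleR: "cscale a (r *\<^sub>R x) = r *\<^sub>R cscale a x" for x :: "'a::cstar_algebra"
  by (simp add: cscale_cscale mult.commute flip: cscale_of_real)

lemma cscale_scaleR_left: "cscale (r *\<^sub>R a) x = r *\<^sub>R cscale a x" for x :: "'a::cstar_algebra"
  by (simp add: cscale_cscale scaleR_conv_of_real flip: cscale_of_real)

lemma norm_square_selfadjoint: "star x = x \<Longrightarrow> norm (x * x) = (norm x)\<^sup>2" for x :: "'a::cstar_algebra"
  using norm_star_mult[of x] by simp

lemma bounded_linear_cscale: "bounded_linear (cscale a :: 'a::cstar_algebra \<Rightarrow> 'a)"
  by (rule bounded_linear_intro[where K="cmod a"])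
    (simp_all add: cscale_add_right cscale_scaleR norm_cscale mult.commute)

lemma bounded_linear_star: "bounded_linear (star :: 'a::cstar_algebra \<Rightarrow> 'a)"
  by (rule bounded_linear_intro[where K=1]) (simp_all add: star_add star_scaleR)

lemmas tendsto_star = bounded_linear.tendsto[OF bounded_linear_star]

section \<open>The unitization, its norm and its involution\<close>

datatype 'a unitization = Unitization (elem: 'a) (scal: complex)

definition act :: "'a::cstar_algebra unitization \<Rightarrow> 'a \<Rightarrow> 'a" where
  "act u y = elem u * y + cscale (scal u) y"

instantiation unitization :: (cstar_algebra) real_algebra_1 begin

definition "0 = Unitization 0 0"
definition "1 = Unitization 0 1"
definition "u + v = Unitization (elem u + elem v) (scal u + scal v)"
definition "u - v = Unitization (elem u - elem v) (scal u - scal v)"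
definition "- u = Unitization (- elem u) (- scal u)"
definition "u * v = Unitization (elem u * elem v + cscale (scal u) (elem v) + cscale (scal v) (elem u))
  (scal u * scal v)"
definition "r *\<^sub>R u = Unitization (r *\<^sub>R elem u) (r *\<^sub>R scal u)"
lemmas unitization_defs = zero_unitization_def one_unitization_def plus_unitization_def
  minus_unitization_def uminus_unitization_def times_unitization_def scaleR_unitization_def

instance
  by standard (simp_all add: unitization_defs algebra_simps cscale_add_left cscale_add_right
      cscale_cscale mult_cscale_left mult_cscale_right cscale_scaleR cscale_scaleR_left unitization.expand)

end

instantiation unitization :: (cstar_algebra) real_normed_algebra_1 begin

text \<open>If the algebra has a unit p, the operator norm of left multiplication is only a
  seminorm, as \<open>Unitization (- p) 1\<close> acts as zero. Taking the maximum with the modulus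
  of the character \<open>scal\<close> restores definiteness in every case.\<close>

definition "norm (u :: 'a unitization) = max (cmod (scal u)) (onorm (act u))"
definition "dist (u :: 'a unitization) v = norm (u - v)"
definition "sgn (u :: 'a unitization) = u /\<^sub>R norm u"
definition "(uniformity :: ('a unitization \<times> 'a unitization) filter) =
  (INF e\<in>{0 <..}. principal {(x, y). dist x y < e})"
definition "open (U :: 'a unitization set) \<longleftrightarrow>
  (\<forall>x\<in>U. eventually (\<lambda>(x', y). x' = x \<longrightarrow> y \<in> U) uniformity)"

lemma bounded_linear_act: "bounded_linear (act (u :: 'a unitization))"
  unfolding act_def
  by (intro bounded_linear_add bounded_linear_mult_right bounded_linear_cscale)

lemma act_mult: "act (u * v) y = act u (act v (y :: 'a))"
  by (simp add: act_def unitization_defs algebra_simps cscale_add_right cscale_cscale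
      mult_cscale_left mult_cscale_right)

lemma act_add: "act (u + v) y = act u y + act v (y :: 'a)"
  by (simp add: act_def unitization_defs algebra_simps cscale_add_left)

lemma act_scaleR: "act (r *\<^sub>R u) y = r *\<^sub>R act u (y :: 'a)"
  by (simp add: act_def scaleR_unitization_def cscale_scaleR_left scaleR_add_right)

lemma norm_act_le: "norm (act u y) \<le> norm u * norm (y :: 'a)"
proof -
  have "onorm (act u) \<le> norm u" by (simp add: norm_unitization_def)
  with onorm[OF bounded_linear_act, of u y] show ?thesis
    by (meson mult_right_mono norm_ge_zero order_trans)
qed

text \<open>Evaluating \<open>act u\<close> at a*, where a is \<open>elem u\<close>, gives a a* plus
  a scalar multiple of a*, and ||a a*|| = ||a||^2.\<close>

lemma norm_elem_le: "norm (elem u) \<le> 2 * norm (u :: 'a unitization)"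
proof -
  let ?a = "elem u"
  have "norm ?a * norm ?a = norm (?a * star ?a)"
    using norm_star_mult[of "star ?a"] by (simp add: star_star power2_eq_square)
  also have "?a * star ?a = act u (star ?a) - cscale (scal u) (star ?a)"
    by (simp add: act_def)
  also have "norm \<dots> \<le> norm (act u (star ?a)) + norm (cscale (scal u) (star ?a))"
    by (rule norm_triangle_ineq4)
  also have "\<dots> \<le> norm u * norm ?a + norm u * norm ?a"
    using norm_act_le[of u "star ?a"]
    by (intro add_mono) (auto simp: norm_cscale norm_unitization_def intro!: mult_right_mono)
  finally have "norm ?a * norm ?a \<le> 2 * norm u * norm ?a" by simp
  then show ?thesis by (cases "norm ?a = 0") (auto simp: norm_unitization_def le_max_iff_disj)
qed

instance
proof
  fix u v w :: "'a unitization" and r s :: real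
  show "norm (r *\<^sub>R u) = \<bar>r\<bar> * norm u"
    by (simp add: norm_unitization_def act_scaleR[abs_def] onorm_scaleR[OF bounded_linear_act]
        max_mult_distrib_left) (simp add: scaleR_unitization_def)
  show "norm (u + v) \<le> norm u + norm v"
  proof -
    have "onorm (act (u + v)) \<le> onorm (act u) + onorm (act v)"
      unfolding act_add[abs_def] by (rule onorm_triangle[OF bounded_linear_act bounded_linear_act])
    moreover have "cmod (scal (u + v)) \<le> cmod (scal u) + cmod (scal v)"
      by (simp add: plus_unitization_def norm_triangle_ineq)
    ultimately show ?thesis unfolding norm_unitization_def by linarith
  qed
  show "norm (u * v) \<le> norm u * norm v"
  proof -
    have "onorm (act (u * v)) \<le> onorm (act u) * onorm (act v)"
      using onorm_compose[OF bounded_linear_act bounded_linear_act, of u v]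
      by (simp add: act_mult[abs_def] comp_def)
    also have "\<dots> \<le> norm u * norm v"
      by (auto simp: norm_unitization_def intro!: mult_mono onorm_pos_le bounded_linear_act le_max_iff_disj[THEN iffD2])
    moreover have "cmod (scal (u * v)) \<le> norm u * norm v"
      by (auto simp: norm_unitization_def norm_mult times_unitization_def intro!: mult_mono le_max_iff_disj[THEN iffD2])
    ultimately show ?thesis by (simp add: norm_unitization_def[of "u * v"])
  qed
  show "norm (1 :: 'a unitization) = 1"
  proof -
    have "act 1 = (\<lambda>y :: 'a. y)" by (auto simp: act_def one_unitization_def)
    then show ?thesis using onorm_id_le[where 'a='a]
      by (simp add: norm_unitization_def one_unitization_def max_absorb1)
  qed
  show "norm u = 0 \<longleftrightarrow> u = 0"
  proof
    assume n0: "norm u = 0"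
    then have "scal u = 0" by (smt (verit) max.cobounded1 norm_le_zero_iff norm_unitization_def)
    moreover have "elem u = 0" using norm_elem_le[of u] n0 by simp
    ultimately show "u = 0" by (simp add: zero_unitization_def unitization.expand)
  next
    assume "u = 0"
    then have "act u = (\<lambda>y. 0)" by (auto simp: act_def zero_unitization_def)
    then show "norm u = 0" using \<open>u = 0\<close>
      by (simp add: norm_unitization_def onorm_zero) (simp add: zero_unitization_def)
  qed
qed (simp_all add: dist_unitization_def sgn_unitization_def uniformity_unitization_def
    open_unitization_def)

end

lemma elem_simps [simp]:
  "elem (u + v) = elem u + elem v" "elem (u - v) = elem u - elem v" "elem (- u) = - elem u"
  "elem (r *\<^sub>R u) = r *\<^sub>R elem u" "elem (0 :: 'a::cstar_algebra unitization) = 0"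
  for u v :: "'a::cstar_algebra unitization"
  by (simp_all add: unitization_defs)

lemma scal_simps [simp]:
  "scal (u + v) = scal u + scal v" "scal (u - v) = scal u - scal v" "scal (- u) = - scal u"
  "scal (u * v) = scal u * scal v" "scal (r *\<^sub>R u) = r *\<^sub>R scal u"
  "scal (0 :: 'a::cstar_algebra unitization) = 0" "scal (1 :: 'a::cstar_algebra unitization) = 1"
  "scal (w ^ n) = scal w ^ n"
  for u v :: "'a::cstar_algebra unitization"
  by (simp_all add: unitization_defs, induction n) (simp_all add: unitization_defs)

lemma norm_scal_le: "cmod (scal u) \<le> norm u"
  by (simp add: norm_unitization_def)

lemma norm_unitization_le: "norm u \<le> norm (elem u) + cmod (scal u)"
proof -
  have "onorm (act u) \<le> norm (elem u) + cmod (scal u)"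
    by (rule onorm_bound)
      (auto simp: act_def norm_cscale distrib_right
        intro!: norm_triangle_le add_mono norm_mult_ineq)
  then show ?thesis by (simp add: norm_unitization_def)
qed

lemma bounded_linear_elem: "bounded_linear (elem :: 'a::cstar_algebra unitization \<Rightarrow> 'a)"
  by (rule bounded_linear_intro[where K=2]) (use norm_elem_le in \<open>simp_all add: mult.commute\<close>)

lemma bounded_linear_scal: "bounded_linear (scal :: 'a::cstar_algebra unitization \<Rightarrow> complex)"
  by (rule bounded_linear_intro[where K=1]) (simp_all add: norm_scal_le)

text \<open>The norm is equivalent to the sum of the norms of both components, so completeness is
  inherited.\<close>

instance unitization :: (cstar_algebra) banach
proof
  fix X :: "nat \<Rightarrow> 'a unitization"
  assume X: "Cauchy X"
  obtain a where a: "(\<lambda>n. elem (X n)) \<longlonglongrightarrow> a"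
    using bounded_linear.Cauchy[OF bounded_linear_elem X] Cauchy_convergent convergentD by blast
  obtain l where l: "(\<lambda>n. scal (X n)) \<longlonglongrightarrow> l"
    using bounded_linear.Cauchy[OF bounded_linear_scal X] Cauchy_convergent convergentD by blast
  have "(\<lambda>n. norm (elem (X n) - a) + cmod (scal (X n) - l)) \<longlonglongrightarrow> 0"
    by (rule tendsto_add_zero; intro tendsto_norm_zero LIM_zero a l)
  then have "(\<lambda>n. X n - Unitization a l) \<longlonglongrightarrow> 0"
    by (rule tendsto_0_le[where K=1, OF _ always_eventually])
      (auto intro: order_trans[OF norm_unitization_le])
  then show "convergent X" using LIM_zero_cancel convergentI by blast
qed

instantiation unitization :: (cstar_algebra) cstar_algebra begin

definition "cscale a u = Unitization (cscale a (elem u)) (a * scal u)"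
definition "star u = Unitization (star (elem u)) (cnj (scal u))"

text \<open>This half of the C*-identity makes \<open>star\<close> isometric, and then
  submultiplicativity gives the other half. It follows from the C*-identity of the algebra, applied
  to each \<open>act u y\<close>.\<close>

lemma norm_star_mult_ge: "(norm u)\<^sup>2 \<le> norm (star u * u)" for u :: "'a unitization"
proof -
  have eq: "star y * act (star u * u) y = star (act u y) * act u y" for y
    by (simp add: act_def star_unitization_def times_unitization_def star_add star_mult star_cscale
        algebra_simps cscale_add_right cscale_cscale mult_cscale_left mult_cscale_right cscale_add_left)
  have "onorm (act u) \<le> sqrt (norm (star u * u))"
  proof (rule onorm_bound)
    fix y
    have "(norm (act u y))\<^sup>2 = norm (star y * act (star u * u) y)"
      by (simp add: eq norm_star_mult)
    also have "\<dots> \<le> norm y * (norm (star u * u) * norm y)" (is "_ \<le> ?r")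
      using norm_mult_ineq[of "star y" "act (star u * u) y"] norm_act_le[of "star u * u" y]
      by (smt (verit) mult_left_mono norm_ge_zero norm_star)
    also have "?r = (sqrt (norm (star u * u)) * norm y)\<^sup>2"
      by (simp add: power_mult_distrib power2_eq_square[of "norm y"])
    finally have "(norm (act u y))\<^sup>2 \<le> (sqrt (norm (star u * u)) * norm y)\<^sup>2" .
    then show "norm (act u y) \<le> sqrt (norm (star u * u)) * norm y"
      by (rule power2_le_imp_le) simp
  qed simp
  moreover have "cmod (scal u) \<le> sqrt (norm (star u * u))"
    using norm_scal_le[of "star u * u"]
    by (simp add: star_unitization_def norm_mult real_le_rsqrt power2_eq_square)
  ultimately have "norm u \<le> sqrt (norm (star u * u))" by (simp add: norm_unitization_def)
  then show ?thesis by (metis norm_ge_zero real_sqrt_ge_0_iff real_sqrt_pow2 power_mono)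
qed

instance
proof
  fix u v :: "'a unitization" and a b :: complex and r :: real
  show st: "star (star w) = w" for w :: "'a unitization"
    by (simp add: star_unitization_def star_star)
  have "norm w \<le> norm (star w)" for w :: "'a unitization"
  proof (cases "norm w = 0")
    case False
    have "norm w * norm w \<le> norm (star w) * norm w"
      using norm_mult_ineq[of "star w" w] norm_star_mult_ge[of w] by (simp add: power2_eq_square)
    then show ?thesis using False by simp
  qed simp
  from this[of u] this[of "star u"] have "norm (star u) = norm u" by (simp add: st)
  then show "norm (star u * u) = (norm u)\<^sup>2"
    using norm_mult_ineq[of "star u" u] norm_star_mult_ge[of u] by (simp add: power2_eq_square)
  have le: "norm (cscale b w) \<le> cmod b * norm w" for b and w :: "'a unitization"
  proof -
    have "act (cscale b w) y = cscale b (act w y)" for y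
      by (simp add: act_def cscale_unitization_def mult_cscale_left cscale_add_right cscale_cscale)
    then have "onorm (act (cscale b w)) \<le> cmod b * norm w"
      by (intro onorm_bound) (auto simp: norm_cscale mult.assoc intro!: mult_left_mono norm_act_le)
    moreover have "cmod (scal (cscale b w)) \<le> cmod b * norm w"
      by (auto simp: cscale_unitization_def norm_mult intro!: mult_left_mono norm_scal_le)
    ultimately show ?thesis by (simp add: norm_unitization_def[of "cscale b w"])
  qed
  show "norm (cscale a u) = cmod a * norm u"
  proof (cases "a = 0")
    case False
    then have "cscale (1 / a) (cscale a u) = u"
      by (simp add: cscale_unitization_def cscale_cscale)
    with le[of "1 / a" "cscale a u"] False have "cmod a * norm u \<le> norm (cscale a u)"
      by (simp add: norm_divide field_simps)
    with le[of a u] show ?thesis by simp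
  qed (simp add: cscale_unitization_def flip: zero_unitization_def)
qed (simp_all add: cscale_unitization_def star_unitization_def unitization_defs cscale_add_right cscale_add_left
    cscale_cscale cscale_of_real star_add star_cscale star_mult mult_cscale_left mult_cscale_right
    algebra_simps scaleR_conv_of_real)

end

definition emb :: "'a::cstar_algebra \<Rightarrow> 'a unitization" where
  "emb a = Unitization a 0"

lemma elem_emb [simp]: "elem (emb a) = a" and scal_emb [simp]: "scal (emb a) = 0"
  by (simp_all add: emb_def)

lemma emb_elem: "scal u = 0 \<Longrightarrow> emb (elem u) = u"
  by (simp add: emb_def unitization.expand)

lemma emb_eq_iff [simp]: "emb a = emb b \<longleftrightarrow> a = b"
  by (simp add: emb_def)

lemma emb_mult: "emb (a * b) = emb a * emb b"
  and emb_star: "emb (star a) = star (emb a)"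
  and emb_scaleR: "emb (r *\<^sub>R a) = r *\<^sub>R emb a"
  by (simp_all add: emb_def unitization_defs star_unitization_def)

section \<open>Roots and approximate inverses in unital C*-algebras\<close>

lemma star_one [simp]: "star (1 :: 'b::{cstar_algebra, real_normed_algebra_1}) = 1"
  by (metis mult.right_neutral star_mult star_star)

lemma star_power: "star (x ^ n) = star x ^ n" for x :: "'b::{cstar_algebra, real_normed_algebra_1}"
  by (induction n) (simp_all add: star_mult power_commutes)

lemma star_sum: "star (\<Sum>i\<in>A. f i) = (\<Sum>i\<in>A. star (f i))" for f :: "'c \<Rightarrow> 'a::cstar_algebra"
  by (induction A rule: infinite_finite_induct) (simp_all add: star_add)

lemma commute_power:
  "z * x = x * z \<Longrightarrow> z * x ^ n = x ^ n * z" for x :: "'b::monoid_mult"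
  by (induction n) (simp_all, metis mult.assoc)

lemma commute_sum:
  "(\<And>i. i \<in> A \<Longrightarrow> z * f i = f i * z) \<Longrightarrow> z * (\<Sum>i\<in>A. f i) = (\<Sum>i\<in>A. f i) * z"
  for z :: "'b::semiring_0"
  by (simp add: sum_distrib_left sum_distrib_right)

text \<open>By the C*-identity, ||x g|| is determined by x* x and g. Elements of equal absolute
  value can thus be exchanged without any order on the algebra.\<close>

lemma norm_mult_cong:
  fixes x y g :: "'a::cstar_algebra"
  assumes "star x * x = star y * y"
  shows "norm (x * g) = norm (y * g)"
proof -
  have "star (z * g) * (z * g) = star g * (star z * z) * g" for z
    by (simp add: star_mult mult.assoc)
  then have "(norm (x * g))\<^sup>2 = (norm (y * g))\<^sup>2"
    unfolding norm_star_mult[symmetric] using assms by simp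
  then show ?thesis by simp
qed

section \<open>Square roots by successive approximation\<close>

lemma square_diff_square_commute:
  "a * b = b * a \<Longrightarrow> a * a - b * b = (a - b) * (a + b)" for a :: "'b::ring"
  by (simp add: algebra_simps)

text \<open>A fixed point s of the recursion satisfies 2 s = t + s^2, that is, (1 - s)^2 = 1 -
  t.\<close>

primrec root_iter :: "'b::real_normed_algebra_1 \<Rightarrow> nat \<Rightarrow> 'b" where
  "root_iter t 0 = 0"
| "root_iter t (Suc n) = (1/2) *\<^sub>R (t + root_iter t n * root_iter t n)"

lemma root_iter_commute:
  assumes "z * t = t * z"
  shows "z * root_iter t n = root_iter t n * z"
proof (induction n)
  case (Suc n)
  have "z * (root_iter t n * root_iter t n) = root_iter t n * root_iter t n * z"
    by (metis Suc mult.assoc)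
  then show ?case using assms by (simp add: algebra_simps)
qed simp

lemma norm_root_iter:
  assumes "norm t \<le> 1"
  shows "norm (root_iter t n) \<le> root_iter (1::real) n"
proof (induction n)
  case (Suc n)
  have "norm (t + root_iter t n * root_iter t n) \<le> 1 + root_iter (1::real) n * root_iter (1::real) n"
    by (intro norm_triangle_mono assms order_trans[OF norm_mult_ineq] mult_mono Suc)
      (use Suc in \<open>auto intro: order_trans[OF norm_ge_zero]\<close>)
  then show ?case by simp
qed simp

lemma root_iter_real: "0 \<le> root_iter (1::real) n" "root_iter (1::real) n \<le> 1"
    "root_iter (1::real) n \<le> root_iter (1::real) (Suc n)"
proof -
  have *: "0 \<le> root_iter (1::real) n \<and> root_iter (1::real) n \<le> 1" for n
    by (induction n) (auto simp: mult_le_one)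
  then show "0 \<le> root_iter (1::real) n" "root_iter (1::real) n \<le> 1" by auto
  have "0 \<le> (root_iter (1::real) n - 1)\<^sup>2" by simp
  then show "root_iter (1::real) n \<le> root_iter (1::real) (Suc n)"
    by (simp add: power2_eq_square algebra_simps)
qed

text \<open>The iterates are polynomials in \<open>t\<close> with nonnegative coefficients, and so are their
  differences; hence everything is dominated by the scalar case \<open>t = 1\<close>.\<close>

lemma norm_root_iter_diff:
  assumes "norm t \<le> 1"
  shows "norm (root_iter t (Suc n) - root_iter t n) \<le> root_iter (1::real) (Suc n) - root_iter 1 n"
proof (induction n)
  case 0
  then show ?case using assms by simp
next
  case (Suc n)
  let ?s = "root_iter t" and ?x = "root_iter (1::real)"
  have c: "?s n * ?s (Suc n) = ?s (Suc n) * ?s n"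
    by (rule root_iter_commute) (rule root_iter_commute[symmetric], rule refl)
  have "?s (Suc (Suc n)) - ?s (Suc n) = (1/2) *\<^sub>R (?s (Suc n) * ?s (Suc n) - ?s n * ?s n)"
    by (simp only: root_iter.simps(2)[of _ "Suc n"])
      (simp add: algebra_simps)
  also have "\<dots> = (1/2) *\<^sub>R ((?s (Suc n) - ?s n) * (?s (Suc n) + ?s n))"
    using c by (simp only: square_diff_square_commute)
  also have "norm \<dots> \<le> (1/2) * ((?x (Suc n) - ?x n) * (?x (Suc n) + ?x n))"
    unfolding norm_scaleR
    by (intro mult_mono order_trans[OF norm_mult_ineq] Suc norm_triangle_mono norm_root_iter assms)
      (use root_iter_real in \<open>auto simp del: root_iter.simps intro: order_trans[OF norm_ge_zero]\<close>)
  also have "\<dots> = ?x (Suc (Suc n)) - ?x (Suc n)"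
    by (simp only: root_iter.simps(2)[of _ "Suc n"]) (simp add: algebra_simps)
  finally show ?case .
qed

text \<open>The increments are dominated by those of the scalar iteration at 1, which is increasing
  and bounded, so the iterates converge even if \<open>t\<close> has norm exactly 1.
  Self-adjointness and commutation relations pass to the limit.\<close>

lemma one_minus_root:
  fixes t :: "'b::{cstar_algebra, real_normed_algebra_1}"
  assumes t: "norm t \<le> 1"
  obtains s where "norm s \<le> 1" "(1 - s) * (1 - s) = 1 - t" "star t = t \<Longrightarrow> star s = s"
    "\<And>z. z * t = t * z \<Longrightarrow> z * s = s * z"
proof -
  let ?s = "root_iter t" and ?x = "root_iter (1::real)"
  have "incseq ?x" by (rule incseq_SucI) (rule root_iter_real)
  moreover have "Bseq ?x"
    by (rule BseqI'[where K=1]) (use root_iter_real in \<open>simp del: root_iter.simps\<close>)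
  ultimately have "convergent ?x"
    by (intro Bseq_mono_convergent) (simp_all add: incseq_def)
  then have "summable (\<lambda>n. ?x (Suc n) - ?x n)"
    using telescope_summable convergent_def by blast
  then have "summable (\<lambda>n. ?s (Suc n) - ?s n)"
    by (rule summable_comparison_test') (use norm_root_iter_diff[OF t] in blast)
  then have "convergent (\<lambda>n. \<Sum>i<n. ?s (Suc i) - ?s i)"
    by (simp add: summable_iff_convergent)
  then obtain s where s: "?s \<longlonglongrightarrow> s"
    unfolding sum_lessThan_telescope by (auto simp: convergent_def)
  show thesis
  proof
    show "norm s \<le> 1"
      by (rule LIMSEQ_le_const2[OF tendsto_norm[OF s]])
        (use norm_root_iter[OF t] root_iter_real order_trans in blast)
    have "(\<lambda>n. ?s (Suc n)) \<longlonglongrightarrow> (1/2) *\<^sub>R (t + s * s)"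
      by (simp only: root_iter.simps) (intro tendsto_intros s)
    with s have "s = (1/2) *\<^sub>R (t + s * s)"
      using LIMSEQ_Suc LIMSEQ_unique by blast
    then have "s + s = t + s * s"
      by (metis scaleR_half_double scaleR_add_right)
    then show "(1 - s) * (1 - s) = 1 - t" by (simp add: algebra_simps)
    show "star s = s" if "star t = t"
    proof -
      have "star (?s n) = ?s n" for n
        by (induction n) (simp_all add: star_scaleR star_add star_mult that)
      then show ?thesis using tendsto_star[OF s] s LIMSEQ_unique by auto
    qed
    show "z * s = s * z" if "z * t = t * z" for z
    proof -
      have "(\<lambda>n. z * ?s n) \<longlonglongrightarrow> z * s" "(\<lambda>n. ?s n * z) \<longlonglongrightarrow> s * z"
        by (intro tendsto_intros s)+
      then show ?thesis using root_iter_commute[OF that] LIMSEQ_unique by auto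
    qed
  qed
qed

text \<open>A substitute for a spectral argument: as 1 - e^2 is the square of a self-adjoint s, it
  is enough to bound the norm of s by 1. The result allows roots of e^2 to be extracted.\<close>

lemma norm_one_minus_square_le:
  fixes e :: "'b::{cstar_algebra, real_normed_algebra_1}"
  assumes e: "star e = e" "norm e \<le> 1"
  shows "norm (1 - e * e) \<le> 1"
proof -
  have "norm (e * e) \<le> 1"
    using e by (simp add: norm_square_selfadjoint power_le_one)
  then obtain t where t: "(1 - t) * (1 - t) = 1 - e * e" "star (e * e) = e * e \<Longrightarrow> star t = t"
    "\<And>z. z * (e * e) = (e * e) * z \<Longrightarrow> z * t = t * z"
    by (rule one_minus_root) blast
  define s where "s = 1 - t"
  have s: "star s = s" "e * s = s * e" "s * s = 1 - e * e"
    using t e by (auto simp: s_def star_diff star_mult algebra_simps)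
  text \<open>\<open>u = e + is\<close> is unitary with imaginary part \<open>s\<close>.\<close>
  define u where "u = e + cscale \<i> s"
  have su: "star u = e - cscale \<i> s"
    using e s by (simp add: u_def star_add star_cscale cscale_minus_left)
  have "star u * u = e * e + s * s"
    by (simp add: su) (simp add: u_def algebra_simps mult_cscale_left mult_cscale_right
        cscale_cscale s(2) cscale_minus_left cscale_diff_right)
  then have "(norm u)\<^sup>2 = 1" using s by (simp flip: norm_star_mult)
  then have nu: "norm u = 1" by (simp add: power2_eq_1_iff) (smt (verit) norm_ge_zero)
  have "s = cscale (- \<i> / 2) (u - star u)"
    unfolding su by (simp add: u_def cscale_add_right cscale_cscale flip: cscale_add_left)
  then have "norm s = (1/2) * norm (u - star u)"
    by (metis norm_cscale norm_divide norm_ii norm_minus_cancel norm_numeral)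
  also have "\<dots> \<le> 1"
    using norm_triangle_ineq4[of u "star u"] nu by simp
  finally have "norm s \<le> 1" .
  then have "(norm s)\<^sup>2 \<le> 1" by (simp add: power_le_one)
  then show ?thesis by (simp add: norm_square_selfadjoint[OF s(1)] flip: s(3))
qed

text \<open>The condition ||1 - v|| <= 1 takes the place of positivity. The root inherits it, so
  roots can be extracted repeatedly.\<close>

lemma positive_root:
  fixes v :: "'b::{cstar_algebra, real_normed_algebra_1}"
  assumes "star v = v" "norm (1 - v) \<le> 1"
  obtains r where "star r = r" "norm (1 - r) \<le> 1" "r * r = v" "\<And>z. z * v = v * z \<Longrightarrow> z * r = r * z"
proof -
  obtain s where s: "norm s \<le> 1" "(1 - s) * (1 - s) = 1 - (1 - v)" "star (1 - v) = 1 - v \<Longrightarrow> star s = s"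
    "\<And>z. z * (1 - v) = (1 - v) * z \<Longrightarrow> z * s = s * z"
    using one_minus_root[OF assms(2)] by metis
  show thesis
  proof (rule that)
    show "star (1 - s) = 1 - s" using s(3) assms by (simp add: star_diff)
    show "norm (1 - (1 - s)) \<le> 1" using s(1) by simp
    show "(1 - s) * (1 - s) = v" using s(2) by simp
    show "z * (1 - s) = (1 - s) * z" if "z * v = v * z" for z
      using s(4)[of z] that by (simp add: right_diff_distrib left_diff_distrib)
  qed
qed

text \<open>As \<open>e\<close> is not known to be positive, roots are taken of its square;
  \<open>q\<close> plays the role of |e|^(2/2^n).\<close>

lemma positive_root_power:
  fixes e :: "'b::{cstar_algebra, real_normed_algebra_1}"
  assumes e: "star e = e" "norm e \<le> 1"
  shows "\<exists>q. star q = q \<and> norm (1 - q) \<le> 1 \<and> q ^ (2 ^ n) = e * e \<and> (\<forall>z. z * e = e * z \<longrightarrow> z * q = q * z)"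
proof (induction n)
  case 0
  have "\<forall>z. z * e = e * z \<longrightarrow> z * (e * e) = e * e * z" by (metis mult.assoc)
  then show ?case using norm_one_minus_square_le[OF e] e by (intro exI[of _ "e * e"]) (simp add: star_mult)
next
  case (Suc n)
  then obtain q where q: "star q = q" "norm (1 - q) \<le> 1" "q ^ (2 ^ n) = e * e"
    "\<And>z. z * e = e * z \<Longrightarrow> z * q = q * z" by blast
  obtain r where r: "star r = r" "norm (1 - r) \<le> 1" "r * r = q" "\<And>z. z * q = q * z \<Longrightarrow> z * r = r * z"
    using positive_root[OF q(1,2)] by blast
  have "r ^ (2 ^ Suc n) = q ^ (2 ^ n)" using r(3) by (simp add: power_mult power2_eq_square)
  then show ?case using q r by metis
qed

section \<open>Self-adjoint elements of the double commutant\<close>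

text \<open>Stands in for real continuous functions of \<open>q\<close>. Any two such elements
  commute.\<close>

definition selfadjoint_function_of :: "'b::cstar_algebra \<Rightarrow> 'b \<Rightarrow> bool" where
  "selfadjoint_function_of q g \<longleftrightarrow> star g = g \<and> (\<forall>z. z * q = q * z \<longrightarrow> z * g = g * z)"

lemma selfadjoint_function_ofI:
  "star g = g \<Longrightarrow> (\<And>z. z * q = q * z \<Longrightarrow> z * g = g * z) \<Longrightarrow> selfadjoint_function_of q g"
  by (simp add: selfadjoint_function_of_def)

lemma selfadjoint_function_ofD:
  assumes "selfadjoint_function_of q g"
  shows "star g = g" "z * q = q * z \<Longrightarrow> z * g = g * z"
  using assms unfolding selfadjoint_function_of_def by blast+

lemma selfadjoint_function_of_commute:
  "selfadjoint_function_of q g \<Longrightarrow> selfadjoint_function_of q h \<Longrightarrow> g * h = h * g"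
  unfolding selfadjoint_function_of_def by metis

lemma selfadjoint_function_of_mult:
  assumes g: "selfadjoint_function_of q g" and h: "selfadjoint_function_of q h"
  shows "selfadjoint_function_of q (g * h)"
proof (rule selfadjoint_function_ofI)
  show "star (g * h) = g * h"
    using selfadjoint_function_ofD(1)[OF g] selfadjoint_function_ofD(1)[OF h]
      selfadjoint_function_of_commute[OF g h] by (simp add: star_mult)
  fix z assume z: "z * q = q * z"
  show "z * (g * h) = g * h * z"
    using selfadjoint_function_ofD(2)[OF g z] selfadjoint_function_ofD(2)[OF h z]
    by (metis mult.assoc)
qed

lemma selfadjoint_function_of_diff:
  assumes g: "selfadjoint_function_of q g" and h: "selfadjoint_function_of q h"
  shows "selfadjoint_function_of q (g - h)"
proof (rule selfadjoint_function_ofI)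
  show "star (g - h) = g - h"
    using selfadjoint_function_ofD(1)[OF g] selfadjoint_function_ofD(1)[OF h] by (simp add: star_diff)
  fix z assume z: "z * q = q * z"
  show "z * (g - h) = (g - h) * z"
    using selfadjoint_function_ofD(2)[OF g z] selfadjoint_function_ofD(2)[OF h z]
    by (simp add: left_diff_distrib right_diff_distrib)
qed

lemma selfadjoint_function_of_scaleR:
  assumes g: "selfadjoint_function_of q g"
  shows "selfadjoint_function_of q (r *\<^sub>R g)"
proof (rule selfadjoint_function_ofI)
  show "star (r *\<^sub>R g) = r *\<^sub>R g" using selfadjoint_function_ofD(1)[OF g] by (simp add: star_scaleR)
  fix z assume z: "z * q = q * z"
  show "z * r *\<^sub>R g = r *\<^sub>R g * z" using selfadjoint_function_ofD(2)[OF g z] by simp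
qed

lemma selfadjoint_function_of_sum:
  assumes "\<And>i. i \<in> A \<Longrightarrow> selfadjoint_function_of q (f i)"
  shows "selfadjoint_function_of q (\<Sum>i\<in>A. f i)"
  by (intro selfadjoint_function_ofI commute_sum)
    (simp_all add: star_sum selfadjoint_function_ofD(1)[OF assms] selfadjoint_function_ofD(2)[OF assms])

lemma selfadjoint_function_of_one:
  "selfadjoint_function_of q (1 :: 'b::{cstar_algebra, real_normed_algebra_1})"
  by (rule selfadjoint_function_ofI) simp_all

lemma selfadjoint_function_of_self: "star q = q \<Longrightarrow> selfadjoint_function_of q q"
  by (rule selfadjoint_function_ofI)

lemma selfadjoint_function_of_power:
  fixes q :: "'b::{cstar_algebra, real_normed_algebra_1}"
  assumes g: "selfadjoint_function_of q g"
  shows "selfadjoint_function_of q (g ^ n)"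
  by (intro selfadjoint_function_ofI commute_power selfadjoint_function_ofD(2)[OF g])
    (simp_all add: star_power selfadjoint_function_ofD(1)[OF g])

lemmas selfadjoint_function_of_intros =
  selfadjoint_function_of_mult selfadjoint_function_of_diff selfadjoint_function_of_scaleR
  selfadjoint_function_of_sum selfadjoint_function_of_one selfadjoint_function_of_self
  selfadjoint_function_of_power

section \<open>Approximate inverses and division by powers\<close>

lemma power_mult_distrib_commute:
  fixes a b :: "'b::monoid_mult"
  assumes "a * b = b * a"
  shows "(a * b) ^ n = a ^ n * b ^ n"
proof (induction n)
  case (Suc n)
  have "a * b * (a ^ n * b ^ n) = a * (b * a ^ n) * b ^ n" by (simp add: mult.assoc)
  also have "\<dots> = a ^ Suc n * b ^ Suc n"
    using commute_power[of b a n] assms by (simp add: mult.assoc)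
  finally show ?case by (simp add: Suc)
qed simp

text \<open>\<open>cesaro q n\<close> tends to the indicator function of \<open>{0}\<close> at \<open>q\<close>, and \<open>cesaro_quotient q n\<close> is
  an approximate inverse of \<open>q\<close>. Averaging makes \<open>q * cesaro q n \<rightarrow> 0\<close> a telescoping sum.\<close>

definition cesaro :: "'b::real_normed_algebra_1 \<Rightarrow> nat \<Rightarrow> 'b" where
  "cesaro q n = (1 / real (Suc n)) *\<^sub>R (\<Sum>k<Suc n. (1 - q) ^ k)"

definition cesaro_quotient :: "'b::real_normed_algebra_1 \<Rightarrow> nat \<Rightarrow> 'b" where
  "cesaro_quotient q n = (1 / real (Suc n)) *\<^sub>R (\<Sum>k<Suc n. \<Sum>i<k. (1 - q) ^ i)"

lemma mult_geometric_sum: "q * (\<Sum>i<k. (1 - q) ^ i) = 1 - (1 - q) ^ k" for q :: "'b::ring_1"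
  by (induction k) (simp_all add: algebra_simps)

lemma mult_cesaro_quotient: "q * cesaro_quotient q n = 1 - cesaro q n"
proof -
  have "q * (\<Sum>k<Suc n. \<Sum>i<k. (1 - q) ^ i) = (\<Sum>k<Suc n. 1 - (1 - q) ^ k)"
    by (subst sum_distrib_left) (simp only: mult_geometric_sum)
  also have "\<dots> = real (Suc n) *\<^sub>R 1 - (\<Sum>k<Suc n. (1 - q) ^ k)"
    by (simp add: sum_subtractf scaleR_conv_of_real del: sum.lessThan_Suc)
  finally show ?thesis
    by (simp add: cesaro_quotient_def cesaro_def scaleR_diff_right del: sum.lessThan_Suc)
qed

lemma norm_cesaro:
  assumes "norm (1 - q) \<le> 1"
  shows "norm (cesaro q n) \<le> 1"
proof -
  have "norm (\<Sum>k<Suc n. (1 - q) ^ k) \<le> of_nat (card {..<Suc n}) * 1"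
    by (intro sum_norm_bound order_trans[OF norm_power_ineq] power_le_one assms norm_ge_zero)
  then show ?thesis by (simp add: cesaro_def field_simps del: sum.lessThan_Suc)
qed

lemma mult_cesaro_tendsto:
  assumes "norm (1 - q) \<le> 1"
  shows "(\<lambda>n. q * cesaro q n) \<longlonglongrightarrow> 0"
proof (rule tendsto_0_le[OF lim_inverse_n'[THEN LIMSEQ_Suc], of _ 2])
  show "\<forall>\<^sub>F n in sequentially. norm (q * cesaro q n) \<le> norm (1 / real (Suc n)) * 2"
  proof (intro always_eventually allI)
    fix n
    have "norm (q * cesaro q n) = (1 / real (Suc n)) * norm (1 - (1 - q) ^ Suc n)"
      by (simp only: cesaro_def mult_scaleR_right mult_geometric_sum norm_scaleR) simp
    also have "norm (1 - (1 - q) ^ Suc n) \<le> norm (1 :: 'a) + norm ((1 - q) ^ Suc n)"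
      by (rule norm_triangle_ineq4)
    also have "\<dots> \<le> 1 + 1"
      by (intro add_mono order_trans[OF norm_power_ineq] power_le_one assms) simp_all
    finally show "norm (q * cesaro q n) \<le> norm (1 / real (Suc n)) * 2"
      by (simp add: divide_right_mono)
  qed
qed

lemma
  fixes q :: "'b::{cstar_algebra, real_normed_algebra_1}"
  assumes "star q = q"
  shows selfadjoint_function_of_cesaro: "selfadjoint_function_of q (cesaro q n)"
    and selfadjoint_function_of_cesaro_quotient: "selfadjoint_function_of q (cesaro_quotient q n)"
  unfolding cesaro_def cesaro_quotient_def
  by (intro selfadjoint_function_of_intros assms)+

text \<open>\<open>1 - cesaro q n\<close> need not tend to 1 in norm, but one factor
  \<open>q\<close> makes the difference vanish, while the remaining factors stay bounded.\<close>

lemma mult_one_minus_cesaro_power_tendsto: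
  assumes "norm (1 - q) \<le> 1"
  shows "(\<lambda>n. q * (1 - cesaro q n) ^ m) \<longlonglongrightarrow> q"
proof (induction m)
  case (Suc m)
  have "(\<lambda>n. q * cesaro q n * (1 - cesaro q n) ^ m) \<longlonglongrightarrow> 0"
  proof (rule tendsto_0_le[OF mult_cesaro_tendsto[OF assms], of _ "2 ^ m"])
    show "\<forall>\<^sub>F n in sequentially. norm (q * cesaro q n * (1 - cesaro q n) ^ m) \<le> norm (q * cesaro q n) * 2 ^ m"
    proof (intro always_eventually allI order_trans[OF norm_mult_ineq] mult_left_mono norm_ge_zero
        order_trans[OF norm_power_ineq] power_mono)
      show "norm (1 - cesaro q n) \<le> 2" for n
        using norm_triangle_ineq4[of 1 "cesaro q n"] norm_cesaro[OF assms, of n] by simp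
    qed
  qed
  from tendsto_diff[OF Suc this] show ?case
    by (simp add: algebra_simps)
qed simp

text \<open>The quotient \<open>y\<close> is the limit of \<open>x * G n\<close>, where
  \<open>G n\<close> approximates an inverse of \<open>q ^ m\<close>. Domination is demanded with
  exponent \<open>Suc m\<close> because \<open>q ^ m * G n\<close> converges only after one more
  multiplication by \<open>q\<close>.\<close>

lemma factor_power:
  fixes q x :: "'b::{cstar_algebra, real_normed_algebra_1, banach}"
  assumes q: "star q = q" "norm (1 - q) \<le> 1"
    and dom: "\<And>g. selfadjoint_function_of q g \<Longrightarrow> norm (x * g) \<le> C * norm (q ^ Suc m * g)"
  obtains y where "x = y * q ^ m"
proof -
  let ?E = "cesaro q"
  define G where "G n = cesaro_quotient q n ^ m" for n
  have fE: "selfadjoint_function_of q (?E n)" and fG: "selfadjoint_function_of q (G n)" for n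
    unfolding G_def by (intro selfadjoint_function_of_intros selfadjoint_function_of_cesaro
        selfadjoint_function_of_cesaro_quotient q)+
  have fq: "selfadjoint_function_of q q" using q(1) by (rule selfadjoint_function_of_self)
  have qG: "q ^ m * G n = (1 - ?E n) ^ m" for n
    unfolding G_def mult_cesaro_quotient[symmetric]
    by (rule power_mult_distrib_commute[symmetric] selfadjoint_function_of_commute[of q]
        fq selfadjoint_function_of_cesaro_quotient q)+
  have lim: "(\<lambda>n. q * (1 - ?E n) ^ m) \<longlonglongrightarrow> q"
    by (rule mult_one_minus_cesaro_power_tendsto[OF q(2)])
  have "Cauchy (\<lambda>n. x * G n)"
  proof (rule CauchyI)
    fix e :: real assume "0 < e"
    define D where "D = \<bar>C\<bar> + 1"
    have "D > 0" by (simp add: D_def)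
    obtain M where M: "\<And>i j. i \<ge> M \<Longrightarrow> j \<ge> M \<Longrightarrow>
        norm (q * (1 - ?E i) ^ m - q * (1 - ?E j) ^ m) < e / D"
      using CauchyD[OF LIMSEQ_imp_Cauchy[OF lim], of "e / D"] \<open>0 < e\<close> \<open>D > 0\<close> by auto
    have "norm (x * G i - x * G j) < e" if "i \<ge> M" "j \<ge> M" for i j
    proof -
      have "norm (x * G i - x * G j) = norm (x * (G i - G j))" by (simp add: right_diff_distrib)
      also have "\<dots> \<le> C * norm (q ^ Suc m * (G i - G j))"
        by (intro dom selfadjoint_function_of_intros fG)
      also have "\<dots> \<le> D * norm (q ^ Suc m * (G i - G j))"
        by (intro mult_right_mono) (auto simp: D_def)
      also have "q ^ Suc m * (G i - G j) = q * (1 - ?E i) ^ m - q * (1 - ?E j) ^ m"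
        by (simp add: mult.assoc right_diff_distrib qG)
      also have "D * norm \<dots> < e" using M[OF that] \<open>D > 0\<close> by (simp add: field_simps)
      finally show ?thesis .
    qed
    then show "\<exists>M. \<forall>i\<ge>M. \<forall>j\<ge>M. norm (x * G i - x * G j) < e" by blast
  qed
  then obtain y where y: "(\<lambda>n. x * G n) \<longlonglongrightarrow> y"
    using Cauchy_convergent convergentD by blast
  \<comment> \<open>A second use of \<open>dom\<close>, now with \<open>1 - G n * q ^ m\<close> as
    test element, identifies \<open>y * q ^ m\<close> with \<open>x\<close>.\<close>
  have "(\<lambda>n. x * (1 - G n * q ^ m)) \<longlonglongrightarrow> 0"
  proof (rule tendsto_0_le[of "\<lambda>n. q ^ m * (q - q * (1 - ?E n) ^ m)" _ _ C])
    show "(\<lambda>n. q ^ m * (q - q * (1 - ?E n) ^ m)) \<longlonglongrightarrow> 0"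
      using tendsto_mult_left[OF tendsto_diff[OF tendsto_const lim], of "q ^ m" q] by simp
    show "\<forall>\<^sub>F n in sequentially. norm (x * (1 - G n * q ^ m)) \<le> norm (q ^ m * (q - q * (1 - ?E n) ^ m)) * C"
    proof (intro always_eventually allI)
      fix n
      have c: "q ^ m * G n = G n * q ^ m"
        by (intro selfadjoint_function_of_commute[of q] selfadjoint_function_of_intros q fG)
      have "norm (x * (1 - G n * q ^ m)) \<le> C * norm (q ^ Suc m * (1 - G n * q ^ m))"
        by (intro dom selfadjoint_function_of_intros fG q)
      also have "q ^ Suc m * (1 - G n * q ^ m) = q ^ m * (q - q * (1 - ?E n) ^ m)"
        by (simp only: c[symmetric] qG power_Suc2) (simp add: algebra_simps)
      finally show "norm (x * (1 - G n * q ^ m)) \<le> norm (q ^ m * (q - q * (1 - ?E n) ^ m)) * C"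
        by (simp add: mult.commute)
    qed
  qed
  then have "(\<lambda>n. x - x * G n * q ^ m) \<longlonglongrightarrow> 0" by (simp add: right_diff_distrib mult.assoc)
  moreover have "(\<lambda>n. x - x * G n * q ^ m) \<longlonglongrightarrow> x - y * q ^ m"
    by (intro tendsto_intros y)
  ultimately have "x = y * q ^ m" using LIMSEQ_unique by fastforce
  then show thesis by (rule that)
qed

section \<open>Factorization by fractional powers\<close>

text \<open>With b = x* x, \<open>r\<close> is |b|^(1/2), and \<open>c\<close>, which amounts to
  sgn(b) |b|^(1/2), is the limit of b times approximate inverses of \<open>r\<close>.\<close>

lemma factor_star_mult_self_contraction:
  fixes x :: "'b::{cstar_algebra, real_normed_algebra_1, banach}"
  assumes x: "norm x \<le> 1"
  obtains c r where "star c = c" "star r = r" "star x * x = c * r"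
    "\<And>g. norm (c * g) \<le> 2 * norm (x * g)" "\<And>g. norm (r * g) \<le> 2 * norm (x * g)"
proof -
  define b where "b = star x * x"
  have b: "star b = b" "norm b \<le> 1"
    using x by (simp_all add: b_def star_mult star_star norm_star_mult power_le_one)
  obtain r where r: "star r = r" "norm (1 - r) \<le> 1" "r ^ (2 ^ 2) = b * b"
    "\<And>z. z * b = b * z \<Longrightarrow> z * r = r * z"
    using positive_root_power[OF b, of 2] by blast
  let ?E = "cesaro r" and ?R = "cesaro_quotient r"
  have rrrr: "r * r * (r * r) = b * b" using r(3) by (simp add: numeral_eq_Suc mult.assoc)
  have br: "b * r = r * b" using r(4) by simp
  have fR: "selfadjoint_function_of r (?R n)" for n
    by (rule selfadjoint_function_of_cesaro_quotient[OF r(1)])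
  note sR = selfadjoint_function_ofD(1)[OF fR]
  have bR: "b * ?R n = ?R n * b" and rR: "r * ?R n = ?R n * r" for n
    using selfadjoint_function_ofD(2)[OF fR] br by simp_all
  \<comment> \<open>The self-adjoint elements b and r^2 have the same square.\<close>
  have nb: "norm (b * f) = norm (r * r * f)" for f
    by (rule norm_mult_cong) (simp add: b r(1) star_mult rrrr)
  have rrR: "r * r * ?R n = r * (1 - ?E n)" for n
    by (simp add: mult.assoc mult_cesaro_quotient)
  have lim: "(\<lambda>n. r * (1 - ?E n)) \<longlonglongrightarrow> r"
    using mult_one_minus_cesaro_power_tendsto[OF r(2), of 1] by simp
  have "norm (b * ?R i - b * ?R j) = norm (r * (1 - ?E i) - r * (1 - ?E j))" for i j
    using nb[of "?R i - ?R j"] by (simp only: right_diff_distrib[of b] right_diff_distrib[of "r * r"] rrR)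
  then have "Cauchy (\<lambda>n. b * ?R n)"
    using LIMSEQ_imp_Cauchy[OF lim] by (simp add: Cauchy_def dist_norm)
  then obtain c where c: "(\<lambda>n. b * ?R n) \<longlonglongrightarrow> c"
    using Cauchy_convergent convergentD by blast
  have sc: "star c = c"
    using tendsto_star[OF c] c LIMSEQ_unique by (simp add: star_mult b(1) sR bR) blast
  have "(\<lambda>n. b * ?E n) \<longlonglongrightarrow> 0"
  proof (rule tendsto_0_le[OF mult_cesaro_tendsto[OF r(2)]])
    show "\<forall>\<^sub>F n in sequentially. norm (b * ?E n) \<le> norm (r * ?E n) * norm r"
      by (simp add: nb mult.assoc mult.commute[of _ "norm r"] norm_mult_ineq)
  qed
  then have "(\<lambda>n. b - b * ?E n) \<longlonglongrightarrow> b - 0" by (intro tendsto_intros)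
  moreover have "b * ?R n * r = b - b * ?E n" for n
  proof -
    have "b * ?R n * r = b * (r * ?R n)" by (simp add: rR mult.assoc)
    then show ?thesis by (simp add: mult_cesaro_quotient right_diff_distrib)
  qed
  ultimately have cr: "c * r = b"
    using tendsto_mult_right[OF c, of r] LIMSEQ_unique by simp
  have "(\<lambda>n. (b * ?R n) * (b * ?R n)) \<longlonglongrightarrow> c * c" by (intro tendsto_intros c)
  moreover have "(b * ?R n) * (b * ?R n) = (r * (1 - ?E n)) * (r * (1 - ?E n))" for n
  proof -
    have "(b * ?R n) * (b * ?R n) = ?R n * (b * b) * ?R n" by (simp add: bR mult.assoc)
    also have "\<dots> = ?R n * r * r * (r * r * ?R n)" by (simp add: mult.assoc flip: rrrr)
    also have "?R n * r * r = r * r * ?R n" by (simp add: mult.assoc flip: rR)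
    finally show ?thesis by (simp only: rrR)
  qed
  moreover have "(\<lambda>n. (r * (1 - ?E n)) * (r * (1 - ?E n))) \<longlonglongrightarrow> r * r" by (intro tendsto_mult lim)
  \<comment> \<open>So \<open>c\<close> and \<open>r\<close> have the same absolute value, and a
    bound for \<open>c\<close> carries over to \<open>r\<close>.\<close>
  ultimately have cc: "c * c = r * r" using LIMSEQ_unique by simp
  \<comment> \<open>In effect, x |b|^(-1/2) is bounded. The bound for \<open>c\<close> then follows
    from \<open>b * ?R n * g = star (x * ?R n) * (x * g)\<close>.\<close>
  have nxR: "norm (x * ?R n) \<le> 2" for n
  proof -
    have "star (x * ?R n) * (x * ?R n) = ?R n * b * ?R n"
      by (simp add: star_mult sR b_def mult.assoc)
    also have "\<dots> = b * (?R n * ?R n)" by (simp only: bR[symmetric] mult.assoc)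
    finally have "(norm (x * ?R n))\<^sup>2 = norm (b * (?R n * ?R n))"
      by (simp flip: norm_star_mult)
    also have "\<dots> = norm ((1 - ?E n) * (1 - ?E n))"
    proof -
      have "r * r * (?R n * ?R n) = (r * ?R n) * (r * ?R n)" by (metis rR mult.assoc)
      then show ?thesis by (simp only: nb mult_cesaro_quotient)
    qed
    also have "\<dots> \<le> (norm (1 - ?E n))\<^sup>2"
      by (simp add: norm_mult_ineq power2_eq_square)
    finally have "norm (x * ?R n) \<le> norm (1 - ?E n)" by (rule power2_le_imp_le) simp
    also have "\<dots> \<le> 2"
      using norm_triangle_ineq4[of 1 "?E n"] norm_cesaro[OF r(2), of n] by simp
    finally show ?thesis .
  qed
  have nc: "norm (c * g) \<le> 2 * norm (x * g)" for g
  proof (rule LIMSEQ_le_const2)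
    show "(\<lambda>n. norm (b * ?R n * g)) \<longlonglongrightarrow> norm (c * g)" by (intro tendsto_intros c)
    have "norm (b * ?R n * g) \<le> 2 * norm (x * g)" for n
    proof -
      have "b * ?R n * g = ?R n * b * g" by (simp only: bR)
      also have "\<dots> = star (x * ?R n) * (x * g)"
        by (simp add: star_mult sR mult.assoc b_def)
      finally have "norm (b * ?R n * g) \<le> norm (x * ?R n) * norm (x * g)"
        using norm_mult_ineq[of "star (x * ?R n)" "x * g"] by simp
      also have "\<dots> \<le> 2 * norm (x * g)" by (intro mult_right_mono nxR) simp
      finally show ?thesis .
    qed
    then show "\<exists>N. \<forall>n\<ge>N. norm (b * ?R n * g) \<le> 2 * norm (x * g)" by blast
  qed
  moreover have "norm (r * g) = norm (c * g)" for g
    by (rule norm_mult_cong) (simp add: sc r(1) cc)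
  ultimately show thesis using that[of c r] sc r(1) cr b_def by simp
qed

lemma factor_star_mult_self:
  fixes x :: "'b::{cstar_algebra, real_normed_algebra_1, banach}"
  obtains c r C where "star c = c" "star r = r" "star x * x = c * r"
    "\<And>g. norm (c * g) \<le> C * norm (x * g)" "\<And>g. norm (r * g) \<le> C * norm (x * g)"
proof -
  define k where "k = norm x + 1"
  have k: "k > 0" by (simp add: k_def add_nonneg_pos)
  have "norm ((1/k) *\<^sub>R x) \<le> 1" using k by (simp add: k_def)
  then obtain c r where cr: "star c = c" "star r = r" "star ((1/k) *\<^sub>R x) * ((1/k) *\<^sub>R x) = c * r"
    "\<And>g. norm (c * g) \<le> 2 * norm ((1/k) *\<^sub>R x * g)" "\<And>g. norm (r * g) \<le> 2 * norm ((1/k) *\<^sub>R x * g)"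
    by (rule factor_star_mult_self_contraction) blast
  show thesis
  proof (rule that[of "k *\<^sub>R c" "k *\<^sub>R r" 2])
    have "star x * x = (k * k) *\<^sub>R (star ((1/k) *\<^sub>R x) * ((1/k) *\<^sub>R x))"
      using k by (simp add: star_scaleR)
    then show "star x * x = k *\<^sub>R c * k *\<^sub>R r" by (simp only: cr(3)) simp
    show "norm (k *\<^sub>R c * g) \<le> 2 * norm (x * g)" "norm (k *\<^sub>R r * g) \<le> 2 * norm (x * g)" for g
      using cr(4,5)[of g] k by (simp_all add: field_simps)
  qed (simp_all add: star_scaleR cr)
qed

text \<open>\<open>factor_power\<close> costs one exponent for each of the factors \<open>c\<close>
  and \<open>r\<close>. Taking adjoints moves the power of \<open>q\<close> in \<open>r\<close> to
  the left, next to that in \<open>c\<close>.\<close>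

lemma star_mult_self_power_factor:
  fixes q z :: "'b::{cstar_algebra, real_normed_algebra_1, banach}"
  assumes q: "star q = q" "norm (1 - q) \<le> 1"
  obtains y w where "star (z * q ^ Suc m) * (z * q ^ Suc m) = y * q ^ (2 * m) * w"
proof -
  obtain c r C where cr: "star c = c" "star r = r" "star (z * q ^ Suc m) * (z * q ^ Suc m) = c * r"
    "\<And>g. norm (c * g) \<le> C * norm (z * q ^ Suc m * g)" "\<And>g. norm (r * g) \<le> C * norm (z * q ^ Suc m * g)"
    using factor_star_mult_self[of "z * q ^ Suc m"] by metis
  have bd: "C * norm (z * q ^ Suc m * g) \<le> (\<bar>C\<bar> * norm z) * norm (q ^ Suc m * g)" for g
  proof -
    have "C * norm (z * q ^ Suc m * g) \<le> \<bar>C\<bar> * norm (z * (q ^ Suc m * g))"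
      by (simp only: mult.assoc) (intro mult_right_mono, auto)
    also have "\<dots> \<le> \<bar>C\<bar> * (norm z * norm (q ^ Suc m * g))"
      by (intro mult_left_mono norm_mult_ineq) simp
    finally show ?thesis by (simp add: mult.assoc)
  qed
  obtain y where y: "c = y * q ^ m" using factor_power[OF q order_trans[OF cr(4) bd]] .
  obtain w where w: "r = w * q ^ m" using factor_power[OF q order_trans[OF cr(5) bd]] .
  have "r = q ^ m * star w" using arg_cong[OF w, of star] by (simp add: cr star_mult star_power q)
  then have "c * r = y * q ^ (2 * m) * star w" by (simp add: y mult.assoc power_add mult_2)
  then show thesis using that cr(3) by simp
qed

text \<open>For \<open>m \<ge> 1\<close>, \<open>d m\<close> is a scalar multiple of \<open>(x\<^sup>* x)\<^bsup>m/16\<^esup>\<close>.\<close>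

lemma fractional_powers:
  fixes x :: "'a::cstar_algebra"
  shows "\<exists>(d :: nat \<Rightarrow> 'a) k :: real. (\<forall>m. star (d m) = d m) \<and>
    (\<forall>m n. d (Suc m) * d (Suc n) = d (Suc m + Suc n)) \<and>
    d 32 = k *\<^sub>R (star x * x * (star x * x)) \<and> (\<exists>u v. x = u * d 5 * v) \<and>
    (\<forall>z n. \<exists>y w. star (z * d (n + 3)) * (z * d (n + 3)) = y * d (2 * n + 2) * w)"
proof -
  \<comment> \<open>Division by \<open>k\<close> makes \<open>e\<close> a contraction; the summand 1
    keeps \<open>k\<close> positive and ensures k <= k^2 below.\<close>
  define k where "k = (norm x)\<^sup>2 + 1"
  have k: "k \<ge> 1" by (simp add: k_def)
  define e where "e = emb ((1/k) *\<^sub>R (star x * x))"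
  have se: "star e = e" by (simp add: e_def star_scaleR star_mult star_star flip: emb_star)
  have "norm e \<le> norm ((1/k) *\<^sub>R (star x * x))"
    using norm_unitization_le[of e] by (simp add: e_def)
  also have "\<dots> \<le> 1" using k by (simp add: norm_star_mult divide_le_eq) (simp add: k_def)
  finally have ne: "norm e \<le> 1" .
  obtain q where q: "star q = q" "norm (1 - q) \<le> 1" "q ^ (2 ^ 5) = e * e"
    "\<And>z. z * e = e * z \<Longrightarrow> z * q = q * z"
    using positive_root_power[OF se ne, of 5] by blast
  have eq: "e * q = q * e" using q(4) by simp
  \<comment> \<open>As \<open>e\<close> lies in the algebra, the character \<open>scal\<close>
    vanishes on \<open>q ^ 32\<close>, hence on \<open>q\<close>.\<close>
  have "scal q ^ 32 = 0" using arg_cong[OF q(3), of scal] by (simp add: e_def)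
  then have sq: "scal q = 0" by simp
  \<comment> \<open>Here \<open>d 0\<close> is 0 and not a unit, so multiplicativity can only be
    claimed for positive indices.\<close>
  define d where "d m = elem (q ^ m)" for m
  have emb_d: "emb (d m) = q ^ m" if "m > 0" for m
    using sq that by (simp add: d_def emb_elem)
  have q16: "q ^ 16 * q ^ 16 = e * e" using q(3) by (simp flip: power_add)
  \<comment> \<open>Since e and q^16 have the same square, ||x g||^2 = k ||e g^2|| = k ||q^8 g||^2.
    Division loses one exponent, which leaves q^7.\<close>
  have "norm (emb x * g) \<le> k * norm (q ^ Suc 7 * g)" if g: "selfadjoint_function_of q g" for g
  proof (rule power2_le_imp_le)
    note sg = selfadjoint_function_ofD(1)[OF g]
    have eg: "e * g = g * e" using selfadjoint_function_ofD(2)[OF g eq] .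
    have qg: "q ^ n * g = g * q ^ n" for n
      using selfadjoint_function_ofD(2)[OF g, of "q ^ n"] by (simp add: power_commutes)
    have s8: "star (q ^ 8 * g) = q ^ 8 * g" by (simp add: star_mult star_power q(1) sg qg)
    have xx: "star (emb x) * emb x = k *\<^sub>R e"
      using k by (simp add: e_def emb_scaleR emb_mult emb_star)
    have "(norm (emb x * g))\<^sup>2 = norm (g * (star (emb x) * emb x) * g)"
      by (simp add: star_mult sg mult.assoc flip: norm_star_mult)
    also have "\<dots> = k * norm (e * (g * g))"
    proof -
      have "g * (k *\<^sub>R e) * g = k *\<^sub>R ((g * e) * g)" by simp
      also have "(g * e) * g = e * (g * g)" by (simp only: eg[symmetric] mult.assoc)
      finally show ?thesis using k by (simp only: xx norm_scaleR)
    qed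
    also have "norm (e * (g * g)) = norm (q ^ 16 * (g * g))"
      by (rule norm_mult_cong) (simp only: se star_power q(1) q16)
    also have "q ^ 16 * (g * g) = q ^ 8 * (q ^ 8 * g) * g" by (simp add: mult.assoc flip: power_add)
    also have "\<dots> = (q ^ 8 * g) * (q ^ 8 * g)" by (metis qg mult.assoc)
    also have "norm \<dots> = (norm (q ^ 8 * g))\<^sup>2" by (rule norm_square_selfadjoint[OF s8])
    also have "k * \<dots> \<le> (k * norm (q ^ 8 * g))\<^sup>2"
      using k by (simp add: power_mult_distrib power2_eq_square[of k] mult_right_mono)
    finally show "(norm (emb x * g))\<^sup>2 \<le> (k * norm (q ^ Suc 7 * g))\<^sup>2" by simp
    show "0 \<le> k * norm (q ^ Suc 7 * g)" using k by simp
  qed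
  then obtain y where y: "emb x = y * q ^ 7" using factor_power[OF q(1,2)] by blast
  show ?thesis
  proof (rule exI[of _ d], rule exI[of _ "1 / k\<^sup>2"], intro conjI allI)
    have "star (q ^ m) = q ^ m" for m by (simp add: star_power q(1))
    then show "star (d m) = d m" for m
      by (simp add: d_def) (metis star_unitization_def unitization.sel(1))
    show "d (Suc m) * d (Suc n) = d (Suc m + Suc n)" for m n
      by (subst emb_eq_iff[symmetric]) (simp only: emb_mult emb_d zero_less_Suc add_pos_pos power_add)
    show "d 32 = (1 / k\<^sup>2) *\<^sub>R (star x * x * (star x * x))"
      by (subst emb_eq_iff[symmetric])
        (use q(3) in \<open>simp add: emb_d e_def emb_scaleR emb_mult power2_eq_square\<close>)
    show "\<exists>u v. x = u * d 5 * v"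
    proof (intro exI)
      \<comment> \<open>Both outer factors must lie in the algebra, and \<open>y\<close> may have a
        scalar part. Hence q^7 is split as q q^5 q.\<close>
      show "x = elem (y * q) * d 5 * d 1"
        by (subst emb_eq_iff[symmetric])
          (simp add: emb_mult emb_d emb_elem sq y mult.assoc numeral_eq_Suc power_commutes)
    qed
    show "\<exists>y w. star (z * d (n + 3)) * (z * d (n + 3)) = y * d (2 * n + 2) * w" for z n
    proof -
      obtain y w where yw: "star (emb z * q ^ Suc (n + 2)) * (emb z * q ^ Suc (n + 2)) = y * q ^ (2 * (n + 2)) * w"
        by (rule star_mult_self_power_factor[OF q(1,2)])
      \<comment> \<open>Again one \<open>q\<close> goes to each outer factor, which leaves 2n + 2 of
        the exponent 2n + 4.\<close>
      have "2 * (n + 2) = Suc (2 * n + 2 + 1)" by simp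
      then have "y * q ^ (2 * (n + 2)) * w = (y * q) * q ^ (2 * n + 2) * (q * w)"
        by (simp only: power_Suc power_add power_one_right mult.assoc)
      moreover have "emb (d (n + 3)) = q ^ Suc (n + 2)" "emb (d (2 * n + 2)) = q ^ (2 * n + 2)"
        using emb_d[of "n + 3"] emb_d[of "2 * n + 2"] by (simp_all add: numeral_eq_Suc)
      moreover have "emb (elem (y * q)) = y * q" "emb (elem (q * w)) = q * w"
        by (simp_all add: emb_elem sq)
      ultimately have "star (z * d (n + 3)) * (z * d (n + 3)) = elem (y * q) * d (2 * n + 2) * elem (q * w)"
        using yw by (subst emb_eq_iff[symmetric]) (simp only: emb_mult emb_star)
      then show ?thesis by blast
    qed
  qed
qed

text \<open>Reduces arbitrary products to squares p* p, to which the factorization above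
  applies.\<close>

lemma polarization:
  fixes x y :: "'a::cstar_algebra"
  shows "star x * y =
    cscale (1/4) (star (x + y) * (x + y)) + cscale (- 1/4) (star (y - x) * (y - x)) +
    cscale (\<i>/4) (star (cscale \<i> x + y) * (cscale \<i> x + y)) +
    cscale (- \<i>/4) (star (y - cscale \<i> x) * (y - cscale \<i> x))" (is "_ = ?r")
proof -
  define p where "p = star x * y"
  define q where "q = star y * x"
  have m1: "cscale (-1) z = - z" for z :: 'a using cscale_minus_left[of 1 z] by simp
  have e1: "star (x + y) * (x + y) - star (y - x) * (y - x) = p + p + q + q"
    by (simp add: star_add star_diff p_def q_def algebra_simps)
  have e2: "star (cscale \<i> x + y) * (cscale \<i> x + y) - star (y - cscale \<i> x) * (y - cscale \<i> x)
      = cscale (-\<i>) (p + p) + cscale \<i> (q + q)"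
    by (simp add: star_add star_diff star_cscale p_def q_def mult_cscale_left mult_cscale_right
        algebra_simps cscale_add_right cscale_diff_right cscale_minus_left)
  have "?r = cscale (1/4) (p + p + q + q) + cscale (\<i>/4) (cscale (-\<i>) (p + p) + cscale \<i> (q + q))"
    unfolding e1[symmetric] e2[symmetric]
    by (simp add: cscale_diff_right cscale_minus_left[of "1/4"] cscale_minus_left[of "\<i>/4"])
  also have "\<dots> = cscale (1/4) (p + p + q + q) + cscale (1/4) (p + p) - cscale (1/4) (q + q)"
    using cscale_minus_left[of "1/4" "q + q"]
    by (simp only: cscale_add_right cscale_cscale) simp
  also have "\<dots> = cscale (1/4 + 1/4 + 1/4 + 1/4) p"
    by (simp only: cscale_add_left cscale_add_right) simp
  finally show ?thesis by (simp add: p_def)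
qed

section \<open>Ideals and nilpotence in rings without unit\<close>

text \<open>Type-class counterpart of \<open>rng_ideal\<close>; see
  \<open>rng_ideal_cstar_ring_iff\<close>.\<close>

definition two_sided_ideal :: "'a::ring set \<Rightarrow> bool" where
  "two_sided_ideal J \<longleftrightarrow> 0 \<in> J \<and> (\<forall>x\<in>J. \<forall>y\<in>J. x - y \<in> J) \<and> (\<forall>x\<in>J. \<forall>a. a * x \<in> J \<and> x * a \<in> J)"

lemma two_sided_idealI:
  assumes "0 \<in> J" "\<And>x y. x \<in> J \<Longrightarrow> y \<in> J \<Longrightarrow> x - y \<in> J"
    "\<And>x a. x \<in> J \<Longrightarrow> a * x \<in> J" "\<And>x a. x \<in> J \<Longrightarrow> x * a \<in> J"
  shows "two_sided_ideal J"
  using assms unfolding two_sided_ideal_def by blast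

context
  fixes J :: "'a::ring set"
  assumes J: "two_sided_ideal J"
begin

lemma two_sided_ideal_zero: "0 \<in> J"
  and two_sided_ideal_diff: "x \<in> J \<Longrightarrow> y \<in> J \<Longrightarrow> x - y \<in> J"
  and two_sided_ideal_mult_left: "x \<in> J \<Longrightarrow> a * x \<in> J"
  and two_sided_ideal_mult_right: "x \<in> J \<Longrightarrow> x * a \<in> J"
  using J unfolding two_sided_ideal_def by blast+

lemma two_sided_ideal_minus: "x \<in> J \<Longrightarrow> - x \<in> J"
  using two_sided_ideal_diff[OF two_sided_ideal_zero] by fastforce

lemma two_sided_ideal_add: "x \<in> J \<Longrightarrow> y \<in> J \<Longrightarrow> x + y \<in> J"
  using two_sided_ideal_diff[OF _ two_sided_ideal_minus] by fastforce

end

lemmas two_sided_ideal_closed = two_sided_ideal_zero two_sided_ideal_diff two_sided_ideal_minus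
  two_sided_ideal_add two_sided_ideal_mult_left two_sided_ideal_mult_right

lemma two_sided_ideal_Inter:
  "(\<And>J. J \<in> \<J> \<Longrightarrow> two_sided_ideal J) \<Longrightarrow> two_sided_ideal (\<Inter>\<J>)"
  by (rule two_sided_idealI) (blast intro: two_sided_ideal_closed)+

section \<open>Sums, powers and nilpotence modulo an ideal\<close>

definition ideal_sum :: "'a::ring set \<Rightarrow> 'a set \<Rightarrow> 'a set" where
  "ideal_sum J K = {x + y | x y. x \<in> J \<and> y \<in> K}"

lemma two_sided_ideal_sum:
  assumes "two_sided_ideal J" "two_sided_ideal K"
  shows "two_sided_ideal (ideal_sum J K)"
proof (rule two_sided_idealI)
  show "0 \<in> ideal_sum J K"
    unfolding ideal_sum_def using assms two_sided_ideal_zero by force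
next
  fix x y assume "x \<in> ideal_sum J K" "y \<in> ideal_sum J K"
  then obtain a b c d where "x = a + b" "y = c + d" "a \<in> J" "b \<in> K" "c \<in> J" "d \<in> K"
    unfolding ideal_sum_def by blast
  then have "x - y = (a - c) + (b - d)" "a - c \<in> J" "b - d \<in> K"
    using assms by (auto intro: two_sided_ideal_diff)
  then show "x - y \<in> ideal_sum J K" unfolding ideal_sum_def by blast
next
  fix x r assume "x \<in> ideal_sum J K"
  then obtain a b where x: "x = a + b" "a \<in> J" "b \<in> K" unfolding ideal_sum_def by blast
  have "r * x = r * a + r * b" "x * r = a * r + b * r" by (simp_all add: x algebra_simps)
  then show "r * x \<in> ideal_sum J K" "x * r \<in> ideal_sum J K"
    using x assms unfolding ideal_sum_def
    by (blast intro: two_sided_ideal_mult_left two_sided_ideal_mult_right)+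
qed

lemma subset_ideal_sum:
  assumes "two_sided_ideal J" "two_sided_ideal K"
  shows "J \<subseteq> ideal_sum J K" "K \<subseteq> ideal_sum J K"
  using two_sided_ideal_zero[OF assms(1)] two_sided_ideal_zero[OF assms(2)]
  unfolding ideal_sum_def by force+

text \<open>\<open>set_pow J n\<close> consists of the products of \<open>n + 1\<close> elements of \<open>J\<close>, without taking sums.\<close>

primrec set_pow :: "'a::ring set \<Rightarrow> nat \<Rightarrow> 'a set" where
  "set_pow J 0 = J"
| "set_pow J (Suc n) = {x * y | x y. x \<in> set_pow J n \<and> y \<in> J}"

text \<open>If \<open>I\<close> is an additive subgroup, single products already decide whether a
  power of an ideal \<open>J\<close> lies in \<open>I\<close>.\<close>

definition nilpotent_modulo :: "'a::ring set \<Rightarrow> 'a set \<Rightarrow> bool" where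
  "nilpotent_modulo I J \<longleftrightarrow> (\<exists>n. set_pow J n \<subseteq> I)"

lemma set_pow_mono: "J \<subseteq> K \<Longrightarrow> set_pow J n \<subseteq> set_pow K n"
  by (induction n) auto

lemma set_pow_add: "set_pow J (Suc (m + n)) \<subseteq> {x * y | x y. x \<in> set_pow J m \<and> y \<in> set_pow J n}"
proof (induction n)
  case (Suc n)
  show ?case
  proof
    fix z assume "z \<in> set_pow J (Suc (m + Suc n))"
    then obtain w y where "z = w * y" "w \<in> set_pow J (Suc (m + n))" "y \<in> J" by auto
    with Suc obtain p r where "z = p * r * y" "p \<in> set_pow J m" "r \<in> set_pow J n" by blast
    then have "z = p * (r * y)" "p \<in> set_pow J m" "r * y \<in> set_pow J (Suc n)"
      using \<open>y \<in> J\<close> by (auto simp: mult.assoc)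
    then show "z \<in> {x * y | x y. x \<in> set_pow J m \<and> y \<in> set_pow J (Suc n)}" by blast
  qed
qed auto

text \<open>The index is one less than the number of factors: (a + 1)(b + 1) factors form b + 1
  blocks of length a + 1.\<close>

lemma set_pow_set_pow: "set_pow J (a * b + a + b) \<subseteq> set_pow (set_pow J a) b"
proof (induction b)
  case (Suc b)
  have "a * Suc b + a + Suc b = Suc ((a * b + a + b) + a)" by simp
  then have "set_pow J (a * Suc b + a + Suc b) \<subseteq>
      {x * y | x y. x \<in> set_pow J (a * b + a + b) \<and> y \<in> set_pow J a}"
    by (simp only: set_pow_add)
  also have "\<dots> \<subseteq> set_pow (set_pow J a) (Suc b)"
    using Suc by (simp only: set_pow.simps) blast
  finally show ?case .
qed simp

lemma set_pow_Suc_subset: "two_sided_ideal I \<Longrightarrow> set_pow J n \<subseteq> I \<Longrightarrow> set_pow J (Suc n) \<subseteq> I"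
  by (auto intro: two_sided_ideal_mult_right)

lemma set_pow_ideal_sum:
  assumes "two_sided_ideal K"
  shows "set_pow (ideal_sum J K) n \<subseteq> ideal_sum (set_pow J n) K"
proof (induction n)
  case (Suc n)
  show ?case
  proof
    fix z assume "z \<in> set_pow (ideal_sum J K) (Suc n)"
    with Suc obtain w y where "z = w * y" "w \<in> ideal_sum (set_pow J n) K" "y \<in> ideal_sum J K" by auto
    then obtain a b c d where z: "z = (a + b) * (c + d)" "a \<in> set_pow J n" "b \<in> K" "c \<in> J" "d \<in> K"
      unfolding ideal_sum_def by blast
    then have "z = a * c + (a * d + b * c + b * d)" by (simp add: algebra_simps)
    moreover have "a * d + b * c + b * d \<in> K"
      using z assms by (intro two_sided_ideal_add two_sided_ideal_mult_left two_sided_ideal_mult_right)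
    ultimately show "z \<in> ideal_sum (set_pow J (Suc n)) K"
      using z unfolding ideal_sum_def by auto
  qed
qed simp

text \<open>Blocks of a + 1 factors land in I + K. In a product of b + 1 blocks only the components
  in \<open>K\<close> matter modulo \<open>I\<close>.\<close>

lemma nilpotent_modulo_ideal_sum:
  assumes I: "two_sided_ideal I" and K: "two_sided_ideal K"
    and "nilpotent_modulo I J" "nilpotent_modulo I K"
  shows "nilpotent_modulo I (ideal_sum J K)"
proof -
  obtain a b where a: "set_pow J a \<subseteq> I" and b: "set_pow K b \<subseteq> I"
    using assms unfolding nilpotent_modulo_def by blast
  have "set_pow (ideal_sum J K) (a * b + a + b) \<subseteq> set_pow (set_pow (ideal_sum J K) a) b"
    by (rule set_pow_set_pow)
  also have "\<dots> \<subseteq> set_pow (ideal_sum K I) b"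
    by (rule set_pow_mono) (use set_pow_ideal_sum[OF K, of J a] a in \<open>force simp: ideal_sum_def add.commute\<close>)
  also have "\<dots> \<subseteq> ideal_sum (set_pow K b) I" by (rule set_pow_ideal_sum[OF I])
  also have "\<dots> \<subseteq> I" using b by (auto simp: ideal_sum_def intro: two_sided_ideal_add[OF I])
  finally show ?thesis unfolding nilpotent_modulo_def by blast
qed

lemma nilpotent_modulo_of_square:
  assumes K: "nilpotent_modulo I K" and JK: "\<And>x y. x \<in> J \<Longrightarrow> y \<in> J \<Longrightarrow> x * y \<in> K"
  shows "nilpotent_modulo I J"
proof -
  have "set_pow J (2 * k + 1) \<subseteq> set_pow K k" for k
  proof (induction k)
    case (Suc k)
    show ?case
    proof
      fix z assume "z \<in> set_pow J (2 * Suc k + 1)"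
      then have "z \<in> set_pow J (Suc (Suc (2 * k + 1)))" by simp
      then obtain w x y where "z = w * x * y" "w \<in> set_pow J (2 * k + 1)" "x \<in> J" "y \<in> J"
        by (simp only: set_pow.simps(2)) blast
      then have "z = w * (x * y)" "w \<in> set_pow K k" "x * y \<in> K"
        using Suc JK by (auto simp: mult.assoc)
      then show "z \<in> set_pow K (Suc k)" by auto
    qed
  qed (use JK in auto)
  with K show ?thesis unfolding nilpotent_modulo_def by (meson order_trans)
qed

definition nilpotent_ideals_union :: "'a::ring set \<Rightarrow> 'a set" where
  "nilpotent_ideals_union I = \<Union>{J. two_sided_ideal J \<and> nilpotent_modulo I J}"

lemma two_sided_ideal_nilpotent_ideals_union:
  assumes I: "two_sided_ideal I"
  shows "two_sided_ideal (nilpotent_ideals_union I)"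
proof (rule two_sided_idealI)
  have "set_pow I 0 \<subseteq> I" by simp
  then have "nilpotent_modulo I I" unfolding nilpotent_modulo_def by blast
  then show "0 \<in> nilpotent_ideals_union I"
    unfolding nilpotent_ideals_union_def using I two_sided_ideal_zero by blast
next
  fix x y assume "x \<in> nilpotent_ideals_union I" "y \<in> nilpotent_ideals_union I"
  then obtain J K where J: "x \<in> J" "two_sided_ideal J" "nilpotent_modulo I J"
    and K: "y \<in> K" "two_sided_ideal K" "nilpotent_modulo I K"
    unfolding nilpotent_ideals_union_def by blast
  have "x - y \<in> ideal_sum J K"
    using J K by (meson subsetD subset_ideal_sum two_sided_ideal_diff two_sided_ideal_sum)
  then show "x - y \<in> nilpotent_ideals_union I"
    using J K I nilpotent_modulo_ideal_sum two_sided_ideal_sum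
    unfolding nilpotent_ideals_union_def by blast
next
  fix x a assume "x \<in> nilpotent_ideals_union I"
  then show "a * x \<in> nilpotent_ideals_union I" "x * a \<in> nilpotent_ideals_union I"
    unfolding nilpotent_ideals_union_def
    by (blast intro: two_sided_ideal_mult_left two_sided_ideal_mult_right)+
qed

text \<open>Each element of \<open>nilpotent_layer I n\<close> lies in a finite sum of ideals of nilpotency exponent
  at most \<open>n + 1\<close> modulo \<open>I\<close>; the exponent of that sum is not bounded in terms of \<open>n\<close>.\<close>

definition nilpotent_layer :: "'a::ring set \<Rightarrow> nat \<Rightarrow> 'a set" where
  "nilpotent_layer I n =
     \<Inter>{M. two_sided_ideal M \<and> (\<forall>J. two_sided_ideal J \<and> set_pow J n \<subseteq> I \<longrightarrow> J \<subseteq> M)}"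

lemma two_sided_ideal_nilpotent_layer: "two_sided_ideal (nilpotent_layer I n)"
  unfolding nilpotent_layer_def by (rule two_sided_ideal_Inter) blast

lemma nilpotent_layer_Suc:
  "two_sided_ideal I \<Longrightarrow> nilpotent_layer I n \<subseteq> nilpotent_layer I (Suc n)"
  unfolding nilpotent_layer_def using set_pow_Suc_subset by (intro Inf_superset_mono) blast

lemma Union_nilpotent_layer:
  assumes "two_sided_ideal I"
  shows "(\<Union>n. nilpotent_layer I n) = nilpotent_ideals_union I"
proof
  \<comment> \<open>\<open>nilpotent_ideals_union I\<close> is itself one of the ideals being
    intersected.\<close>
  have "nilpotent_layer I n \<subseteq> nilpotent_ideals_union I" for n
    unfolding nilpotent_layer_def using two_sided_ideal_nilpotent_ideals_union[OF assms]
    by (intro Inter_lower) (auto simp: nilpotent_ideals_union_def nilpotent_modulo_def)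
  then show "(\<Union>n. nilpotent_layer I n) \<subseteq> nilpotent_ideals_union I" by blast
  show "nilpotent_ideals_union I \<subseteq> (\<Union>n. nilpotent_layer I n)"
    unfolding nilpotent_ideals_union_def nilpotent_modulo_def nilpotent_layer_def by blast
qed

section \<open>Prime ideals\<close>

definition prime_ideal :: "'a::ring set \<Rightarrow> bool" where
  "prime_ideal P \<longleftrightarrow> two_sided_ideal P \<and> P \<noteq> UNIV \<and>
     (\<forall>J K. two_sided_ideal J \<longrightarrow> two_sided_ideal K \<longrightarrow> (\<forall>x\<in>J. \<forall>y\<in>K. x * y \<in> P) \<longrightarrow> J \<subseteq> P \<or> K \<subseteq> P)"

lemma prime_idealD:
  "prime_ideal P \<Longrightarrow> two_sided_ideal J \<Longrightarrow> two_sided_ideal K \<Longrightarrow> (\<And>x y. x \<in> J \<Longrightarrow> y \<in> K \<Longrightarrow> x * y \<in> P)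
    \<Longrightarrow> J \<subseteq> P \<or> K \<subseteq> P"
  unfolding prime_ideal_def by blast

text \<open>\<open>J\<close> is an ideal containing \<open>x\<close>, and its annihilator
  \<open>K\<close> modulo \<open>P\<close> contains all multiples a y. If \<open>K\<close> lies in
  \<open>P\<close>, then \<open>y\<close> lies in the ideal \<open>S\<close>, which primeness puts
  inside \<open>P\<close> because the whole ring times \<open>S\<close> is. This detour replaces
  principal ideals, which are awkward without a unit.\<close>

lemma prime_ideal_sandwich:
  assumes P: "prime_ideal P" and xy: "\<And>a. x * a * y \<in> P"
  shows "x \<in> P \<or> y \<in> P"
proof -
  have iP: "two_sided_ideal P" using P by (simp add: prime_ideal_def)
  note cl = two_sided_ideal_closed[OF iP]
  define J where "J = {u. \<forall>a. u * a * y \<in> P}"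
  have J: "two_sided_ideal J"
  proof (rule two_sided_idealI)
    fix u r assume u: "u \<in> J"
    show "r * u \<in> J" using u cl(5) by (simp add: J_def mult.assoc)
    have "u * r * a * y = u * (r * a) * y" for a by (simp add: mult.assoc)
    with u show "u * r \<in> J" by (simp add: J_def del: mult.assoc)
  qed (auto simp: J_def left_diff_distrib intro: cl)
  define K where "K = {w. \<forall>u\<in>J. u * w \<in> P}"
  have K: "two_sided_ideal K"
  proof (rule two_sided_idealI)
    fix w r assume w: "w \<in> K"
    show "w * r \<in> K" using w cl(6) by (simp add: K_def flip: mult.assoc)
    show "r * w \<in> K" using w two_sided_ideal_mult_right[OF J] by (simp add: K_def flip: mult.assoc)
  qed (auto simp: K_def right_diff_distrib intro: cl)
  define S where "S = {v. \<forall>a. a * v \<in> P}"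
  have S: "two_sided_ideal S"
  proof (rule two_sided_idealI)
    fix v r assume v: "v \<in> S"
    show "r * v \<in> S" using v by (simp add: S_def flip: mult.assoc)
    show "v * r \<in> S" using v cl(6) by (simp add: S_def flip: mult.assoc)
  qed (auto simp: S_def right_diff_distrib intro: cl)
  have "J \<subseteq> P \<or> K \<subseteq> P" using P J K by (rule prime_idealD) (simp add: K_def)
  then show ?thesis
  proof
    assume "J \<subseteq> P"
    then show ?thesis using xy by (auto simp: J_def)
  next
    assume "K \<subseteq> P"
    moreover have "a * y \<in> K" for a by (simp add: K_def J_def flip: mult.assoc)
    ultimately have "y \<in> S" by (auto simp: S_def)
    have "two_sided_ideal (UNIV :: 'a set)" by (rule two_sided_idealI) simp_all
    with P have "UNIV \<subseteq> P \<or> S \<subseteq> P" by (rule prime_idealD[OF _ _ S]) (simp add: S_def)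
    then show ?thesis using P \<open>y \<in> S\<close> by (auto simp: prime_ideal_def)
  qed
qed

text \<open>If some \<open>x\<close> in \<open>J\<close> is outside \<open>P\<close>, the sandwich
  property extends any product outside \<open>P\<close> by a further factor a x from
  \<open>J\<close>, so no power of \<open>J\<close> falls into \<open>P\<close>.\<close>

lemma nilpotent_ideals_union_subset_prime:
  assumes P: "prime_ideal P" and "I \<subseteq> P"
  shows "nilpotent_ideals_union I \<subseteq> P"
proof -
  have "x \<in> P" if J: "two_sided_ideal J" "set_pow J n \<subseteq> I" "x \<in> J" for J x n
  proof (rule ccontr)
    assume x: "x \<notin> P"
    have "\<exists>w\<in>set_pow J n. w \<notin> P" for n
    proof (induction n)
      case (Suc n)
      then obtain w where w: "w \<in> set_pow J n" "w \<notin> P" by blast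
      then obtain a where "w * a * x \<notin> P" using prime_ideal_sandwich[OF P, of w x] x by blast
      moreover have "a * x \<in> J" using J by (auto intro: two_sided_ideal_mult_left)
      ultimately show ?case using w by (auto simp: mult.assoc)
    qed (use x J in auto)
    then show False using J \<open>I \<subseteq> P\<close> by blast
  qed
  then show ?thesis unfolding nilpotent_ideals_union_def nilpotent_modulo_def by blast
qed

text \<open>The range of \<open>s\<close> is an m-system in the sense of McCoy; an ideal that is maximal among
  those avoiding it is prime.\<close>

lemma prime_ideal_avoiding:
  assumes W: "two_sided_ideal W" and semiprime: "\<And>w. w \<notin> W \<Longrightarrow> \<exists>a. w * a * w \<notin> W" and x: "x \<notin> W"
  obtains P where "prime_ideal P" "W \<subseteq> P" "x \<notin> P"
proof -
  obtain f where f: "\<And>w. w \<notin> W \<Longrightarrow> w * f w * w \<notin> W" using semiprime by metis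
  define s where "s = rec_nat x (\<lambda>_ w. w * f w * w)"
  have s0: "s 0 = x" and sS: "s (Suc n) = s n * f (s n) * s n" for n by (simp_all add: s_def)
  have sW: "s n \<notin> W" for n by (induction n) (simp_all add: s0 sS x f)
  let ?\<A> = "{P. two_sided_ideal P \<and> W \<subseteq> P \<and> (\<forall>n. s n \<notin> P)}"
  have "\<exists>P\<in>?\<A>. \<forall>X\<in>?\<A>. P \<subseteq> X \<longrightarrow> X = P"
  proof (rule subset_Zorn_nonempty)
    show "?\<A> \<noteq> {}" using W sW by blast
    fix \<C> assume \<C>: "\<C> \<noteq> {}" "subset.chain ?\<A> \<C>"
    have mem: "\<And>C. C \<in> \<C> \<Longrightarrow> C \<in> ?\<A>" and tot: "\<And>C D. C \<in> \<C> \<Longrightarrow> D \<in> \<C> \<Longrightarrow> C \<subseteq> D \<or> D \<subseteq> C"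
      using \<C> by (auto simp: subset_chain_def)
    have "two_sided_ideal (\<Union>\<C>)"
    proof (rule two_sided_idealI)
      show "0 \<in> \<Union>\<C>" using \<C>(1) mem two_sided_ideal_zero by blast
      fix u v assume "u \<in> \<Union>\<C>" "v \<in> \<Union>\<C>"
      then obtain C where "C \<in> \<C>" "u \<in> C" "v \<in> C" using tot by blast
      then show "u - v \<in> \<Union>\<C>" using mem two_sided_ideal_diff by blast
    qed (use mem two_sided_ideal_mult_left two_sided_ideal_mult_right in blast)+
    then show "\<Union>\<C> \<in> ?\<A>" using \<C>(1) mem by blast
  qed
  then obtain P where PA: "P \<in> ?\<A>" and Pmax: "\<forall>X\<in>?\<A>. P \<subseteq> X \<longrightarrow> X = P" ..
  have P: "two_sided_ideal P" "W \<subseteq> P" "\<And>n. s n \<notin> P" using PA by auto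
  have max: "X = P" if "two_sided_ideal X" "\<And>n. s n \<notin> X" "P \<subseteq> X" for X
    using Pmax P(2) that by auto
  \<comment> \<open>By maximality, every ideal properly enlarging \<open>P\<close> meets the
    sequence.\<close>
  have hit: "\<exists>n. s n \<in> ideal_sum P J" if J: "two_sided_ideal J" "\<not> J \<subseteq> P" for J
  proof (rule ccontr)
    assume "\<nexists>n. s n \<in> ideal_sum P J"
    then have "ideal_sum P J = P"
      by (intro max two_sided_ideal_sum subset_ideal_sum P(1) J(1)) simp
    then show False using subset_ideal_sum(2)[OF P(1) J(1)] J(2) by simp
  qed
  \<comment> \<open>Each term is a multiple of the earlier ones, so two ideals that meet the
    sequence share a term.\<close>
  have up: "s (n + k) \<in> K" if "two_sided_ideal K" "s n \<in> K" for K n k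
    by (induction k) (use that in \<open>auto simp: sS intro: two_sided_ideal_mult_left\<close>)
  have "prime_ideal P"
    unfolding prime_ideal_def
  proof (intro conjI allI impI)
    show "P \<noteq> UNIV" using P(3) by blast
    fix J K assume J: "two_sided_ideal J" and K: "two_sided_ideal K" and JK: "\<forall>x\<in>J. \<forall>y\<in>K. x * y \<in> P"
    show "J \<subseteq> P \<or> K \<subseteq> P"
    proof (rule ccontr)
      assume "\<not> (J \<subseteq> P \<or> K \<subseteq> P)"
      then obtain i j where "s i \<in> ideal_sum P J" "s j \<in> ideal_sum P K" using hit J K by blast
      then have "s (i + j) \<in> ideal_sum P J" "s (i + j) \<in> ideal_sum P K"
        using up[OF two_sided_ideal_sum[OF P(1) J], of i j] up[OF two_sided_ideal_sum[OF P(1) K], of j i]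
        by (simp_all add: add.commute)
      moreover from this(2) have "f (s (i + j)) * s (i + j) \<in> ideal_sum P K"
        by (rule two_sided_ideal_mult_left[OF two_sided_ideal_sum[OF P(1) K]])
      ultimately obtain a b c d where ab: "s (i + j) = a + b" "a \<in> P" "b \<in> J"
        and cd: "f (s (i + j)) * s (i + j) = c + d" "c \<in> P" "d \<in> K"
        unfolding ideal_sum_def by blast
      have "s (Suc (i + j)) = (a + b) * (c + d)"
        unfolding sS mult.assoc cd(1) by (simp add: ab(1))
      also have "\<dots> = a * c + a * d + b * c + b * d" by (simp add: algebra_simps)
      also have "\<dots> \<in> P"
        using ab cd JK
        by (intro two_sided_ideal_add[OF P(1)])
          (auto intro: two_sided_ideal_mult_left[OF P(1)] two_sided_ideal_mult_right[OF P(1)])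
      finally show False using P(3) by blast
    qed
  qed (rule P)
  then show thesis using that P(2) P(3)[of 0] s0 by simp
qed

section \<open>Powers of elements and ideals generated by an element\<close>

definition suc_pow :: "'a::ring \<Rightarrow> nat \<Rightarrow> 'a" where
  "suc_pow x n = ((\<lambda>y. y * x) ^^ n) x"

lemma suc_pow_simps [simp]: "suc_pow x 0 = x" "suc_pow x (Suc n) = suc_pow x n * x"
  by (simp_all add: suc_pow_def)

lemma suc_pow_commute: "suc_pow x n * x = x * suc_pow x n"
  by (induction n) (simp_all, metis mult.assoc)

lemma suc_pow_square_eq: "suc_pow (x * x) n = suc_pow x n * suc_pow x n"
proof (induction n)
  case (Suc n)
  have "suc_pow x n * suc_pow x n * (x * x) = suc_pow x n * (suc_pow x n * x) * x"
    by (simp add: mult.assoc)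
  also have "\<dots> = suc_pow x n * x * (suc_pow x n * x)"
    by (metis suc_pow_commute mult.assoc)
  finally show ?case by (simp add: Suc)
qed simp

lemma suc_pow_in_set_pow: "x \<in> J \<Longrightarrow> suc_pow x n \<in> set_pow J n"
  by (induction n) auto

lemma nilpotent_ideals_union_nil:
  "x \<in> nilpotent_ideals_union I \<Longrightarrow> \<exists>n. suc_pow x n \<in> I"
  unfolding nilpotent_ideals_union_def nilpotent_modulo_def using suc_pow_in_set_pow by blast

text \<open>In the absence of a unit, this ideal generated by the set of all \<open>u * d * v\<close> need not
  contain \<open>d\<close>.\<close>

definition generated_ideal :: "'a::ring \<Rightarrow> 'a set" where
  "generated_ideal d = \<Inter>{J. two_sided_ideal J \<and> (\<forall>u v. u * d * v \<in> J)}"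

lemma two_sided_ideal_generated_ideal: "two_sided_ideal (generated_ideal d)"
  unfolding generated_ideal_def by (rule two_sided_ideal_Inter) blast

lemma generated_ideal_mem: "u * d * v \<in> generated_ideal d"
  unfolding generated_ideal_def by blast

lemma generated_ideal_subset:
  "two_sided_ideal J \<Longrightarrow> (\<And>u v. u * d * v \<in> J) \<Longrightarrow> generated_ideal d \<subseteq> J"
  unfolding generated_ideal_def by blast

text \<open>For generators, (u d v)(u' d v') = u (d (v u') d) v', so only products occur between the
  two \<open>d\<close>; this is what polarization can treat. Two residual ideals extend the claim
  from generators to each factor in turn.\<close>

lemma generated_ideal_mult:
  assumes K: "two_sided_ideal K" and d: "\<And>r s. d * (r * s) * d \<in> K"
    and x: "x \<in> generated_ideal d" and y: "y \<in> generated_ideal d"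
  shows "x * y \<in> K"
proof -
  note cl = two_sided_ideal_closed[OF K]
  let ?G = "generated_ideal d"
  have "?G \<subseteq> {w. \<forall>u v. u * d * v * w \<in> K}"
  proof (rule generated_ideal_subset)
    show "two_sided_ideal {w. \<forall>u v. u * d * v * w \<in> K}"
    proof (rule two_sided_idealI; clarsimp)
      fix w a u v assume w: "\<forall>u v. u * d * v * w \<in> K"
      from w[rule_format, of u "v * a"] show "u * d * v * (a * w) \<in> K" by (simp add: mult.assoc)
      from cl(6)[OF w[rule_format, of u v]] show "u * d * v * (w * a) \<in> K" by (simp add: mult.assoc)
    qed (auto simp: right_diff_distrib intro: cl)
    show "u * d * v \<in> {w. \<forall>u v. u * d * v * w \<in> K}" for u v
    proof (clarsimp)
      fix u' v'
      have "u' * (d * (v' * u) * d) * v \<in> K" by (intro cl(5,6) d)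
      then show "u' * d * v' * (u * d * v) \<in> K" by (simp add: mult.assoc)
    qed
  qed
  then have "?G \<subseteq> {w. \<forall>z\<in>?G. w * z \<in> K}"
  proof (intro generated_ideal_subset)
    show "two_sided_ideal {w. \<forall>z\<in>?G. w * z \<in> K}"
    proof (rule two_sided_idealI; clarsimp)
      fix w a z assume w: "\<forall>z\<in>?G. w * z \<in> K" and z: "z \<in> ?G"
      show "a * w * z \<in> K" using cl(5)[of "w * z" a] w z by (simp add: mult.assoc)
      have "a * z \<in> ?G" using two_sided_ideal_generated_ideal z by (rule two_sided_ideal_mult_left)
      then show "w * a * z \<in> K" using w by (simp add: mult.assoc)
    qed (auto simp: left_diff_distrib intro: cl)
  qed auto
  then show ?thesis using x y by blast
qed

section \<open>Nilpotence of the ideals generated by fractional powers\<close>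

lemma mem_nilpotent_ideals_unionI:
  fixes I :: "'a::cstar_algebra set"
  assumes I: "two_sided_ideal I" and n: "suc_pow (star x * x) n \<in> I"
  shows "x \<in> nilpotent_ideals_union I"
proof -
  define e where "e = star x * x"
  obtain d :: "nat \<Rightarrow> 'a" and k where sd: "\<And>m. star (d m) = d m"
    and d_add: "\<And>m n. d (Suc m) * d (Suc n) = d (Suc m + Suc n)"
    and d32: "d 32 = k *\<^sub>R (e * e)"
    and x5: "\<exists>u v. x = u * d 5 * v"
    and d_fac: "\<And>z n. \<exists>y w. star (z * d (n + 3)) * (z * d (n + 3)) = y * d (2 * n + 2) * w"
    using fractional_powers[of x] unfolding e_def by blast
  have d_pow: "d (32 * Suc j) = k ^ Suc j *\<^sub>R suc_pow (e * e) j" for j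
  proof (induction j)
    case (Suc j)
    have "Suc (31 + 32 * j) = 32 * Suc j" "Suc 31 = (32::nat)" "32 * Suc j + 32 = 32 * Suc (Suc j)"
      by simp_all
    then have "d (32 * Suc (Suc j)) = d (32 * Suc j) * d 32"
      using d_add[of "31 + 32 * j" 31] by (simp only:)
    then show ?case by (simp only: Suc d32 suc_pow_simps mult_scaleR_left mult_scaleR_right) simp
  qed (simp add: d32)
  \<comment> \<open>\<open>I\<close> need not be closed under real scalars. The extra exponent
    supplies a ring factor \<open>d (Suc 0)\<close> that absorbs the power of
    \<open>k\<close>.\<close>
  define M where "M = 32 * Suc n + 1"
  have "Suc (31 + 32 * n) = 32 * Suc n" "32 * Suc n + Suc 0 = M" by (simp_all add: M_def)
  then have "d M = d (32 * Suc n) * d (Suc 0)"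
    using d_add[of "31 + 32 * n" 0] by (simp only:)
  also have "\<dots> = suc_pow (e * e) n * (k ^ Suc n *\<^sub>R d (Suc 0))" by (simp add: d_pow del: mult_Suc_right)
  also have "suc_pow (e * e) n = suc_pow e n * suc_pow e n" by (rule suc_pow_square_eq)
  also have "suc_pow e n * suc_pow e n * (k ^ Suc n *\<^sub>R d (Suc 0)) \<in> I"
    using n unfolding e_def by (intro two_sided_ideal_mult_right[OF I])
  finally have dM: "d M \<in> I" .
  have dI: "d m \<in> I" if "m \<ge> M" for m
  proof (cases "m = M")
    case False
    then obtain j where "m = M + Suc j" using \<open>m \<ge> M\<close> by (metis le_neq_implies_less less_imp_Suc_add add_Suc_right)
    then have "d m = d M * d (Suc j)" using d_add[of "32 * Suc n" j] by (simp add: M_def)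
    then show ?thesis using dM by (simp add: two_sided_ideal_mult_right[OF I])
  qed (use dM in simp)
  let ?G = "\<lambda>m. generated_ideal (d m)"
  text \<open>Bracketing a product of two elements of the ideal generated by \<open>d (m + 3)\<close> so that both
    factors \<open>d (m + 3)\<close> come out in a square \<open>(z d (m + 3))\<^sup>* (z d (m + 3))\<close> almost doubles the
    exponent.\<close>
  have doubling: "x * y \<in> ?G (2 * m + 2)" if "x \<in> ?G (m + 3)" "y \<in> ?G (m + 3)" for x y m
  proof (rule generated_ideal_mult[OF two_sided_ideal_generated_ideal _ that])
    note cl = two_sided_ideal_closed[OF two_sided_ideal_generated_ideal[of "d (2 * m + 2)"]]
    have sq: "d (m + 3) * cscale c (star p * p) * d (m + 3) \<in> ?G (2 * m + 2)" for c p
    proof -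
      obtain y w where yw: "star (p * d (m + 3)) * (p * d (m + 3)) = y * d (2 * m + 2) * w"
        using d_fac by blast
      have "d (m + 3) * cscale c (star p * p) * d (m + 3) = cscale c (star (p * d (m + 3)) * (p * d (m + 3)))"
        by (simp add: star_mult sd mult.assoc mult_cscale_left mult_cscale_right)
      \<comment> \<open>The ideal is not assumed closed under complex scalars, so \<open>c\<close>
        is moved into the left factor.\<close>
      also have "\<dots> = cscale c y * d (2 * m + 2) * w"
        by (simp only: yw mult_cscale_left)
      finally show ?thesis using generated_ideal_mem by simp
    qed
    fix v u :: 'a
    have "v * u = star (star v) * u" by (simp add: star_star)
    then show "d (m + 3) * (v * u) * d (m + 3) \<in> ?G (2 * m + 2)"
      using polarization[of "star v" u]
      by (simp only: distrib_left[of "d (m + 3)"] distrib_right[of _ _ "d (m + 3)"]) (intro cl(4) sq)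
  qed
  \<comment> \<open>The step from m + 3 to 2m + 2 takes 2^j + 4 to 2^(j+1) + 4. Induction descends
    from an exponent beyond \<open>M\<close>, where the ideal lies in \<open>I\<close>, and reaches
    2^0 + 4 = 5, the exponent available for \<open>x\<close>.\<close>
  have "nilpotent_modulo I (?G (2 ^ a + 4))" for a
  proof -
    have "a \<le> a + M" by simp
    then show ?thesis
    proof (induction rule: inc_induct)
      case base
      have "M \<le> 2 ^ (a + M) + 4" using less_exp[of "a + M"] by linarith
      then have "?G (2 ^ (a + M) + 4) \<subseteq> I"
        by (intro generated_ideal_subset I two_sided_ideal_mult_left two_sided_ideal_mult_right dI)
      then have "set_pow (?G (2 ^ (a + M) + 4)) 0 \<subseteq> I" by simp
      then show ?case unfolding nilpotent_modulo_def by blast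
    next
      case (step j)
      have "2 ^ j + 1 + 3 = 2 ^ j + (4::nat)" "2 * (2 ^ j + 1) + 2 = 2 ^ Suc j + (4::nat)" by simp_all
      note sq = doubling[where m = "2 ^ j + 1", unfolded this]
      show ?case by (rule nilpotent_modulo_of_square[OF step(3) sq])
    qed
  qed
  from this[of 0] have "nilpotent_modulo I (?G 5)" by simp
  moreover have "x \<in> ?G 5" using x5 generated_ideal_mem by blast
  ultimately show ?thesis
    unfolding nilpotent_ideals_union_def using two_sided_ideal_generated_ideal by blast
qed

section \<open>Transfer to the structures of HOL-Algebra\<close>

text \<open>The common situation of \<open>cstar_ring\<close> (with \<open>\<pi> = id\<close>) and of its quotients (with \<open>\<pi>\<close> the
  coset map).\<close>

locale ring_image =
  fixes R :: "('b, 'c) ring_scheme" and \<pi> :: "'a::ring \<Rightarrow> 'b"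
  assumes carrier: "carrier R = range \<pi>"
    and add: "\<pi> x \<oplus>\<^bsub>R\<^esub> \<pi> y = \<pi> (x + y)"
    and mult: "\<pi> x \<otimes>\<^bsub>R\<^esub> \<pi> y = \<pi> (x * y)"
    and zero: "\<zero>\<^bsub>R\<^esub> = \<pi> 0"
begin

lemma inv_add_monoid: "inv\<^bsub>add_monoid R\<^esub> (\<pi> x) = \<pi> (- x)"
  unfolding m_inv_def
proof (rule the_equality)
  show "\<pi> (- x) \<in> carrier (add_monoid R) \<and> \<pi> x \<otimes>\<^bsub>add_monoid R\<^esub> \<pi> (- x) = \<one>\<^bsub>add_monoid R\<^esub> \<and>
      \<pi> (- x) \<otimes>\<^bsub>add_monoid R\<^esub> \<pi> x = \<one>\<^bsub>add_monoid R\<^esub>"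
    by (simp add: carrier add zero)
next
  fix y
  assume y: "y \<in> carrier (add_monoid R) \<and> \<pi> x \<otimes>\<^bsub>add_monoid R\<^esub> y = \<one>\<^bsub>add_monoid R\<^esub> \<and>
      y \<otimes>\<^bsub>add_monoid R\<^esub> \<pi> x = \<one>\<^bsub>add_monoid R\<^esub>"
  then obtain z where z: "y = \<pi> z" by (auto simp: carrier)
  with y have "\<pi> (x + z) = \<pi> 0" by (simp add: add zero)
  then have "\<pi> (- x) \<oplus>\<^bsub>R\<^esub> \<pi> (x + z) = \<pi> (- x) \<oplus>\<^bsub>R\<^esub> \<pi> 0" by simp
  then show "y = \<pi> (- x)" by (simp add: add z)
qed

lemma additive_subgroup_vimage:
  assumes "additive_subgroup J R"
  shows "0 \<in> \<pi> -` J" "x \<in> \<pi> -` J \<Longrightarrow> y \<in> \<pi> -` J \<Longrightarrow> x - y \<in> \<pi> -` J"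
proof -
  have J: "subgroup J (add_monoid R)" using assms by (simp add: additive_subgroup_def)
  show "0 \<in> \<pi> -` J" using subgroup.one_closed[OF J] by (simp add: zero)
  assume "x \<in> \<pi> -` J" "y \<in> \<pi> -` J"
  then have "\<pi> x \<in> J" "\<pi> (- y) \<in> J"
    using subgroup.m_inv_closed[OF J, of "\<pi> y"] by (simp_all add: inv_add_monoid)
  then show "x - y \<in> \<pi> -` J"
    using subgroup.m_closed[OF J, of "\<pi> x" "\<pi> (- y)"] by (simp add: add)
qed

lemma rng_left_idealD: "rng_left_ideal J R \<Longrightarrow> \<pi> x \<in> J \<Longrightarrow> \<pi> (a * x) \<in> J"
  by (auto simp: rng_left_ideal_def carrier simp flip: mult)

lemma rng_right_idealD: "rng_right_ideal J R \<Longrightarrow> \<pi> x \<in> J \<Longrightarrow> \<pi> (x * a) \<in> J"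
  by (auto simp: rng_right_ideal_def carrier simp flip: mult)

lemma two_sided_ideal_vimage:
  assumes "rng_ideal J R"
  shows "two_sided_ideal (\<pi> -` J)"
proof -
  have J: "rng_left_ideal J R" "rng_right_ideal J R" using assms by (simp_all add: rng_ideal_def)
  then have "additive_subgroup J R" by (simp add: rng_left_ideal_def)
  then show ?thesis
    by (intro two_sided_idealI additive_subgroup_vimage)
      (auto intro: rng_left_idealD[OF J(1)] rng_right_idealD[OF J(2)])
qed

lemma rng_ideal_image:
  assumes J: "two_sided_ideal J"
  shows "rng_ideal (\<pi> ` J) R"
proof -
  note cl = two_sided_ideal_closed[OF J]
  have "subgroup (\<pi> ` J) (add_monoid R)"
  proof (rule subgroup.intro)
    fix y assume "y \<in> \<pi> ` J"
    then obtain x where "y = \<pi> x" "x \<in> J" by blast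
    then show "inv\<^bsub>add_monoid R\<^esub> y \<in> \<pi> ` J" by (simp only: inv_add_monoid) (blast intro: cl)
  qed (auto simp: carrier add zero intro!: imageI cl)
  moreover have "\<pi> (a * x) \<in> \<pi> ` J" "\<pi> (x * a) \<in> \<pi> ` J" if "x \<in> J" for a x
    using that by (blast intro: cl)+
  ultimately show ?thesis
    by (auto simp: rng_ideal_def rng_left_ideal_def rng_right_ideal_def additive_subgroup_def
        carrier mult)
qed

lemma rng_ideal_mult_subset:
  assumes P: "rng_ideal P R" and JK: "\<And>x y. x \<in> J \<Longrightarrow> y \<in> K \<Longrightarrow> x \<otimes>\<^bsub>R\<^esub> y \<in> P"
  shows "rng_ideal_mult R J K \<subseteq> P"
proof
  have P': "subgroup P (add_monoid R)"
    using P by (simp add: rng_ideal_def rng_left_ideal_def additive_subgroup_def)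
  fix z assume "z \<in> rng_ideal_mult R J K"
  then have "z \<in> generate (add_monoid R) {x \<otimes>\<^bsub>R\<^esub> y |x y. x \<in> J \<and> y \<in> K}"
    by (simp add: rng_ideal_mult_def)
  then show "z \<in> P"
  proof (induction rule: generate.induct)
    case one
    show ?case by (rule subgroup.one_closed[OF P'])
  next
    case (incl h)
    then show ?case using JK by blast
  next
    case (inv h)
    then show ?case using JK by (blast intro: subgroup.m_inv_closed[OF P'])
  next
    case (eng h1 h2)
    then show ?case by (blast intro: subgroup.m_closed[OF P'])
  qed
qed

lemma rng_pow_image: "rng_pow R (\<pi> x) (Suc n) = \<pi> (suc_pow x n)"
proof -
  have "((\<lambda>y. y \<otimes>\<^bsub>R\<^esub> \<pi> x) ^^ n) (\<pi> x) = \<pi> (suc_pow x n)"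
    by (induction n) (simp_all add: mult)
  then show ?thesis by (simp add: rng_pow_def)
qed

lemma ex_rng_pow_iff: "(\<exists>n\<ge>1. rng_pow R (\<pi> x) n \<in> A) \<longleftrightarrow> (\<exists>n. \<pi> (suc_pow x n) \<in> A)"
proof
  assume "\<exists>n\<ge>1. rng_pow R (\<pi> x) n \<in> A"
  then obtain n where "n \<ge> 1" "rng_pow R (\<pi> x) n \<in> A" by blast
  then show "\<exists>n. \<pi> (suc_pow x n) \<in> A"
    by (cases n) (auto simp: rng_pow_image)
next
  assume "\<exists>n. \<pi> (suc_pow x n) \<in> A"
  then obtain n where "rng_pow R (\<pi> x) (Suc n) \<in> A" by (auto simp: rng_pow_image)
  then show "\<exists>n\<ge>1. rng_pow R (\<pi> x) n \<in> A" by (intro exI[of _ "Suc n"]) simp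
qed

text \<open>Brings primes of a quotient back to the algebra, where
  \<open>nilpotent_ideals_union_subset_prime\<close> applies.\<close>

lemma prime_ideal_vimage:
  assumes P: "rng_prime_ideal P R"
  shows "prime_ideal (\<pi> -` P)"
  unfolding prime_ideal_def
proof (intro conjI allI impI)
  have iP: "rng_ideal P R" and "P \<noteq> carrier R" using P by (simp_all add: rng_prime_ideal_def)
  then show "two_sided_ideal (\<pi> -` P)" by (intro two_sided_ideal_vimage)
  have "P \<subseteq> carrier R"
    using iP subgroup.subset[of P "add_monoid R"]
    by (simp add: rng_ideal_def rng_left_ideal_def additive_subgroup_def)
  then show "\<pi> -` P \<noteq> UNIV" using \<open>P \<noteq> carrier R\<close> by (auto simp: carrier)
  fix J K :: "'a set"
  assume J: "two_sided_ideal J" and K: "two_sided_ideal K" and JK: "\<forall>x\<in>J. \<forall>y\<in>K. x * y \<in> \<pi> -` P"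
  have "rng_ideal_mult R (\<pi> ` J) (\<pi> ` K) \<subseteq> P"
    by (rule rng_ideal_mult_subset[OF iP]) (use JK in \<open>auto simp: mult\<close>)
  then have "\<pi> ` J \<subseteq> P \<or> \<pi> ` K \<subseteq> P"
    using P rng_ideal_image[OF J] rng_ideal_image[OF K] by (simp add: rng_prime_ideal_def)
  then show "J \<subseteq> \<pi> -` P \<or> K \<subseteq> \<pi> -` P" by blast
qed

end

section \<open>C*-algebras and their quotients as HOL-Algebra rings\<close>

interpretation cstar_ring: ring_image "cstar_ring :: 'a::cstar_algebra ring" "\<lambda>x. x"
  by standard (simp_all add: cstar_ring_def)

lemma rng_ideal_cstar_ring_iff: "rng_ideal J (cstar_ring :: 'a::cstar_algebra ring) \<longleftrightarrow> two_sided_ideal J"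
  using cstar_ring.two_sided_ideal_vimage[of J] cstar_ring.rng_ideal_image[of J] by auto

lemma rng_prime_ideal_cstar_ring_iff:
  "rng_prime_ideal P (cstar_ring :: 'a::cstar_algebra ring) \<longleftrightarrow> prime_ideal P"
proof
  assume P: "prime_ideal P"
  then have "J \<subseteq> P \<or> K \<subseteq> P"
    if "two_sided_ideal J" "two_sided_ideal K" "rng_ideal_mult cstar_ring J K \<subseteq> P" for J K
  proof (rule prime_idealD[OF _ that(1,2)])
    fix x y assume "x \<in> J" "y \<in> K"
    then have "x \<otimes>\<^bsub>cstar_ring\<^esub> y \<in> rng_ideal_mult cstar_ring J K"
      unfolding rng_ideal_mult_def by (intro generate.incl) blast
    then show "x * y \<in> P" using that(3) by (auto simp: cstar_ring.mult)
  qed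
  with P show "rng_prime_ideal P cstar_ring"
    by (simp add: rng_prime_ideal_def rng_ideal_cstar_ring_iff prime_ideal_def cstar_ring.carrier)
qed (use cstar_ring.prime_ideal_vimage[of P] in simp)

lemma coset_cstar_ring: "I +>\<^bsub>cstar_ring\<^esub> x = {h + x | h. h \<in> I}"
  by (auto simp: a_r_coset_def r_coset_def cstar_ring_def)

lemma coset_cstar_ring_eq_iff:
  assumes I: "two_sided_ideal I"
  shows "I +>\<^bsub>cstar_ring\<^esub> x = I +>\<^bsub>cstar_ring\<^esub> y \<longleftrightarrow> x - y \<in> I"
proof
  assume eq: "I +>\<^bsub>cstar_ring\<^esub> x = I +>\<^bsub>cstar_ring\<^esub> y"
  have "0 + x \<in> I +>\<^bsub>cstar_ring\<^esub> x"
    unfolding coset_cstar_ring using two_sided_ideal_zero[OF I] by blast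
  then have "0 + x \<in> I +>\<^bsub>cstar_ring\<^esub> y" by (simp only: eq)
  then obtain h where "0 + x = h + y" "h \<in> I" unfolding coset_cstar_ring by blast
  then show "x - y \<in> I" by simp
next
  assume xy: "x - y \<in> I"
  have "h + x = (h + (x - y)) + y" "h + y = (h - (x - y)) + x" for h by simp_all
  moreover have "h + (x - y) \<in> I" "h - (x - y) \<in> I" if "h \<in> I" for h
    using that xy two_sided_ideal_add[OF I] two_sided_ideal_diff[OF I] by blast+
  ultimately show "I +>\<^bsub>cstar_ring\<^esub> x = I +>\<^bsub>cstar_ring\<^esub> y"
    unfolding coset_cstar_ring by blast
qed

lemma ring_image_quotient:
  assumes I: "two_sided_ideal (I :: 'a::cstar_algebra set)"
  shows "ring_image (cstar_ring Quot I) (\<lambda>x. I +>\<^bsub>cstar_ring\<^esub> x)"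
proof
  note cl = two_sided_ideal_closed[OF I]
  let ?\<pi> = "\<lambda>x. I +>\<^bsub>cstar_ring\<^esub> x"
  fix x y :: 'a
  show "carrier (cstar_ring Quot I) = range ?\<pi>"
    by (auto simp: FactRing_def A_RCOSETS_def RCOSETS_def a_r_coset_def cstar_ring.carrier)
  show "\<zero>\<^bsub>cstar_ring Quot I\<^esub> = ?\<pi> 0"
    by (simp add: FactRing_def coset_cstar_ring)
  show "?\<pi> x \<oplus>\<^bsub>cstar_ring Quot I\<^esub> ?\<pi> y = ?\<pi> (x + y)"
  proof -
    have "?\<pi> x \<oplus>\<^bsub>cstar_ring Quot I\<^esub> ?\<pi> y = {a + b | a b. a \<in> ?\<pi> x \<and> b \<in> ?\<pi> y}"
      by (auto simp: FactRing_def set_add_def set_mult_def cstar_ring.add)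
    also have "\<dots> = ?\<pi> (x + y)"
    proof (intro equalityI subsetI)
      fix z assume "z \<in> {a + b | a b. a \<in> ?\<pi> x \<and> b \<in> ?\<pi> y}"
      then obtain h k where "z = (h + x) + (k + y)" "h \<in> I" "k \<in> I" unfolding coset_cstar_ring by blast
      then have "z = (h + k) + (x + y)" "h + k \<in> I" by (auto intro: cl)
      then show "z \<in> ?\<pi> (x + y)" unfolding coset_cstar_ring by blast
    next
      fix z assume "z \<in> ?\<pi> (x + y)"
      then obtain h where "z = (h + x) + (0 + y)" "h \<in> I" unfolding coset_cstar_ring by (auto simp: add.assoc)
      then show "z \<in> {a + b | a b. a \<in> ?\<pi> x \<and> b \<in> ?\<pi> y}" unfolding coset_cstar_ring using cl(1) by blast
    qed
    finally show ?thesis .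
  qed
  show "?\<pi> x \<otimes>\<^bsub>cstar_ring Quot I\<^esub> ?\<pi> y = ?\<pi> (x * y)"
  proof -
    \<comment> \<open>The product in the quotient is a union over all pairs of representatives; each
      pair contributes the same coset.\<close>
    have eq: "?\<pi> (a * b) = ?\<pi> (x * y)" if ab: "a \<in> ?\<pi> x" "b \<in> ?\<pi> y" for a b
    proof -
      obtain h k where "a = h + x" "b = k + y" "h \<in> I" "k \<in> I" using ab unfolding coset_cstar_ring by blast
      then have "a * b - x * y = h * (k + y) + x * k" "h * (k + y) + x * k \<in> I"
        by (auto simp: algebra_simps intro: cl)
      then show ?thesis by (simp add: coset_cstar_ring_eq_iff[OF I])
    qed
    have ne: "?\<pi> z \<noteq> {}" for z unfolding coset_cstar_ring using cl(1) by blast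
    have "(\<Union>a\<in>?\<pi> x. \<Union>b\<in>?\<pi> y. ?\<pi> (a * b)) = (\<Union>a\<in>?\<pi> x. \<Union>b\<in>?\<pi> y. ?\<pi> (x * y))"
      by (intro SUP_cong refl eq)
    also have "\<dots> = ?\<pi> (x * y)" by (simp add: ne)
    finally have "(\<Union>a\<in>?\<pi> x. \<Union>b\<in>?\<pi> y. ?\<pi> (a * b)) = ?\<pi> (x * y)" .
    then show ?thesis by (simp add: FactRing_def rcoset_mult_def cstar_ring.mult)
  qed
qed

section \<open>The semiprime closure and nil one-sided ideals\<close>

lemma mem_nilpotent_ideals_union_if_star_mult_mem:
  assumes I: "two_sided_ideal I" and x: "star x * x \<in> nilpotent_ideals_union I"
  shows "x \<in> nilpotent_ideals_union (I :: 'a::cstar_algebra set)"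
  using nilpotent_ideals_union_nil[OF x] mem_nilpotent_ideals_unionI[OF I] by blast

lemma semiprime_closure_cstar_ring:
  assumes I: "two_sided_ideal (I :: 'a::cstar_algebra set)"
  shows "semiprime_closure cstar_ring I = nilpotent_ideals_union I" (is "_ = ?W")
proof
  have W: "two_sided_ideal ?W" by (rule two_sided_ideal_nilpotent_ideals_union[OF I])
  show "?W \<subseteq> semiprime_closure cstar_ring I"
    using nilpotent_ideals_union_subset_prime
    by (auto simp: semiprime_closure_def cstar_ring.carrier rng_prime_ideal_cstar_ring_iff)
  have "I \<subseteq> ?W"
  proof -
    have "set_pow I 0 \<subseteq> I" by simp
    then show ?thesis using I unfolding nilpotent_ideals_union_def nilpotent_modulo_def by blast
  qed
  have semiprime: "\<exists>a. w * a * w \<notin> ?W" if "w \<notin> ?W" for w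
  proof (rule ccontr)
    assume "\<nexists>a. w * a * w \<notin> ?W"
    \<comment> \<open>The choice a = w* leads to the square of w* w; the preceding lemma then
      applies twice, to w* w and to w.\<close>
    then have "w * star w * w \<in> ?W" by blast
    then have "star w * (w * star w * w) \<in> ?W" by (rule two_sided_ideal_mult_left[OF W])
    then have "star (star w * w) * (star w * w) \<in> ?W" by (simp add: star_mult star_star mult.assoc)
    then show False using that mem_nilpotent_ideals_union_if_star_mult_mem[OF I] by blast
  qed
  show "semiprime_closure cstar_ring I \<subseteq> ?W"
  proof (rule subsetI, rule ccontr)
    fix x assume x: "x \<in> semiprime_closure cstar_ring I" "x \<notin> ?W"
    obtain P where "prime_ideal P" "?W \<subseteq> P" "x \<notin> P"
      using prime_ideal_avoiding[OF W semiprime x(2)] by blast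
    then show False using x(1) \<open>I \<subseteq> ?W\<close>
      by (auto simp: semiprime_closure_def rng_prime_ideal_cstar_ring_iff)
  qed
qed

theorem corollaryD:
  fixes I :: "'a::cstar_algebra set"
  assumes "rng_ideal I cstar_ring"
  shows "(\<exists>L :: nat \<Rightarrow> 'a set.
            (\<forall>n. L n \<subseteq> L (Suc n)) \<and>
            (\<forall>n. rng_ideal (L n) cstar_ring \<and> radical_over cstar_ring (L n) I) \<and>
            semiprime_closure cstar_ring I = (\<Union>n. L n)) \<and>
         (\<forall>N. (rng_left_ideal N (cstar_ring Quot I) \<or> rng_right_ideal N (cstar_ring Quot I)) \<and>
              rng_nil (cstar_ring Quot I) N \<longrightarrow>
              N \<subseteq> prime_radical (cstar_ring Quot I))"
proof (intro conjI allI impI)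
  let ?W = "nilpotent_ideals_union I"
  have I: "two_sided_ideal I" using assms by (simp add: rng_ideal_cstar_ring_iff)
  show "\<exists>L. (\<forall>n. L n \<subseteq> L (Suc n)) \<and>
      (\<forall>n. rng_ideal (L n) cstar_ring \<and> radical_over cstar_ring (L n) I) \<and>
      semiprime_closure cstar_ring I = (\<Union>n. L n)"
  proof (intro exI conjI allI)
    show "nilpotent_layer I n \<subseteq> nilpotent_layer I (Suc n)" for n
      by (rule nilpotent_layer_Suc[OF I])
    show "rng_ideal (nilpotent_layer I n) cstar_ring" for n
      by (simp add: rng_ideal_cstar_ring_iff two_sided_ideal_nilpotent_layer)
    show "radical_over cstar_ring (nilpotent_layer I n) I" for n
      unfolding radical_over_def cstar_ring.ex_rng_pow_iff
      using Union_nilpotent_layer[OF I] nilpotent_ideals_union_nil by blast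
    show "semiprime_closure cstar_ring I = (\<Union>n. nilpotent_layer I n)"
      by (simp add: semiprime_closure_cstar_ring[OF I] Union_nilpotent_layer[OF I])
  qed
  let ?Q = "cstar_ring Quot I"
  let ?\<pi> = "\<lambda>x. I +>\<^bsub>cstar_ring\<^esub> x"
  interpret Q: ring_image ?Q ?\<pi> by (rule ring_image_quotient[OF I])
  fix N assume N: "(rng_left_ideal N ?Q \<or> rng_right_ideal N ?Q) \<and> rng_nil ?Q N"
  have nil: "y \<in> ?W" if yy: "?\<pi> (star y * y) \<in> N" for y
  proof -
    have "\<exists>n\<ge>1. rng_pow ?Q (?\<pi> (star y * y)) n \<in> {\<zero>\<^bsub>?Q\<^esub>}" using N yy by (auto simp: rng_nil_def)
    then obtain n where "?\<pi> (suc_pow (star y * y) n) = ?\<pi> 0"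
      unfolding Q.ex_rng_pow_iff by (auto simp: Q.zero)
    then have "suc_pow (star y * y) n \<in> I" by (simp add: coset_cstar_ring_eq_iff[OF I])
    then show ?thesis by (rule mem_nilpotent_ideals_unionI[OF I])
  qed
  have W: "x \<in> ?W" if x: "?\<pi> x \<in> N" for x
  proof (cases "rng_left_ideal N ?Q")
    case True
    then show ?thesis using nil Q.rng_left_idealD x by blast
  next
    case False
    \<comment> \<open>A right ideal contains the class of x x* instead, which puts x* into
      \<open>?W\<close>. As \<open>?W\<close> is two-sided, w* w for w = x lies there too, and one
      more step reaches x.\<close>
    then have "?\<pi> (star (star x) * star x) \<in> N"
      using N Q.rng_right_idealD[OF _ x] by (simp add: star_star)
    then have "star x \<in> ?W" by (rule nil)
    then have "star x * x \<in> ?W"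
      by (rule two_sided_ideal_mult_right[OF two_sided_ideal_nilpotent_ideals_union[OF I]])
    then show ?thesis by (rule mem_nilpotent_ideals_union_if_star_mult_mem[OF I])
  qed
  show "N \<subseteq> prime_radical ?Q"
  proof
    fix z assume z: "z \<in> N"
    have "N \<subseteq> carrier ?Q"
      using N subgroup.subset[of N "add_monoid ?Q"]
      by (auto simp: rng_left_ideal_def rng_right_ideal_def additive_subgroup_def)
    then obtain x where x: "z = ?\<pi> x" using z by (auto simp: Q.carrier)
    have "z \<in> P" if P: "rng_prime_ideal P ?Q" "{\<zero>\<^bsub>?Q\<^esub>} \<subseteq> P" for P
    proof -
      \<comment> \<open>Classes of elements of \<open>I\<close> are zero, so the preimage of
        \<open>P\<close> is a prime ideal over \<open>I\<close> and contains
        \<open>?W\<close>.\<close>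
      have "I \<subseteq> ?\<pi> -` P"
      proof
        fix y assume "y \<in> I"
        then have "?\<pi> y = ?\<pi> 0" by (simp add: coset_cstar_ring_eq_iff[OF I])
        then show "y \<in> ?\<pi> -` P" using P(2) by (simp add: Q.zero)
      qed
      then have "?W \<subseteq> ?\<pi> -` P"
        by (rule nilpotent_ideals_union_subset_prime[OF Q.prime_ideal_vimage[OF P(1)]])
      then show ?thesis using W z x by auto
    qed
    then show "z \<in> prime_radical ?Q"
      using \<open>N \<subseteq> carrier ?Q\<close> z by (auto simp: prime_radical_def semiprime_closure_def)
  qed
qed

end
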